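(* For every $2\le p<\infty$ there is a constant $C_p>0$, depending only on $p$, such that for all $m,n\ge1$, every $k\in[n]$ and every $f:\mathbb{Z}_{2m}^n\to\mathbb{C}$ with $\widehat f(0)=0$, $$\frac1{\binom nk}\sum_{\substack{\mathsf S\subseteq[n]\\ |\mathsf S|=k}}\Big\|\sum_{g\in\mathbb{Z}_{2m}^{\mathsf S}}\widehat f(g)e^{\frac{\pi i}{m}\langle\cdot,g\rangle}\Big\|_p^p\ \le\ C_p\bigg(\frac kn\sum_{j=1}^n\|\partial_jf\|_p^p+\Big(\frac kn\Big)^{p/2}\|f\|_p^p\bigg)$$ and, moreover, $$\frac kn\sum_{j=1}^n\|\partial_jf\|_p^p+\Big(\frac kn\Big)^{p/2}\|f\|_p^p\ \le\ C_p\bigg(\frac kn\sum_{j=1}^n\big\|(\partial_{u_j(1)}+\partial_{u_j(m)})f\big\|_p^p+\Big(\frac kn\Big)^{p/2}\|f\|_p^p\bigg).$$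
   Context: $[n]=\{1,\dots,n\}$; $\mathbb{Z}_{2m}=\mathbb{Z}/2m\mathbb{Z}$. $\|\cdot\|_p$ is the $L_p$-norm on $\mathbb{Z}_{2m}^n$ with normalized counting measure, and $f:\mathbb{Z}_{2m}^n\to\mathbb{C}$ has Fourier expansion $f(x)=\sum_{g\in\mathbb{Z}_{2m}^n}\widehat f(g)e^{\frac{\pi i}{m}\langle x,g\rangle}$. For $\mathsf S\subset[n]$, $\mathbb{Z}_{2m}^{\mathsf S}$ is the subgroup of those $g\in\mathbb{Z}_{2m}^n$ with $g_j=0$ for $j\notin\mathsf S$. Write $\chi_g=e^{\frac{\pi i}{m}\langle\cdot,g\rangle}$ and represent each coordinate $g_j$ by an integer in $\{0,1,\dots,2m-1\}$. The following are Fourier multipliers: $\partial_j\chi_g=\delta_{g_j\neq0}\,\chi_g$, and for $\ell\in\{1,\dots,m\}$, $\partial_{u_j(\ell)}\chi_g=2\pi i\,\delta_{\{\ell\le g_j<\ell+m\}}\,\chi_g$. *)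

theory Defs
  imports "HOL-Analysis.Analysis" "HOL-Algebra.Elementary_Groups" "HOL-Algebra.Product_Groups"
begin

text \<open>
  For \<open>m \<ge> 1\<close> the carrier of \<open>Zpow m n\<close> consists of the functions that are \<open>undefined\<close> outside
  \<open>{1..n}\<close> and take values in \<open>{0..2m-1}\<close> on \<open>{1..n}\<close>, so coordinates are automatically given by
  their representatives in \<open>{0..2m-1}\<close>. Functions on the group have type
  \<open>(nat \<Rightarrow> int) \<Rightarrow> complex\<close>; only their values on the carrier enter the definitions below.
\<close>

definition Zpow :: "nat \<Rightarrow> nat \<Rightarrow> (nat \<Rightarrow> int) monoid" where
  "Zpow m n = product_group {1..n} (\<lambda>_. integer_mod_group (2 * m))"

definition Zsub :: "nat \<Rightarrow> nat \<Rightarrow> nat set \<Rightarrow> (nat \<Rightarrow> int) set" where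
  "Zsub m n S = {g \<in> carrier (Zpow m n). \<forall>j\<in>{1..n} - S. g j = 0}"

definition pairing :: "nat \<Rightarrow> (nat \<Rightarrow> int) \<Rightarrow> (nat \<Rightarrow> int) \<Rightarrow> int" where
  "pairing n x g = (\<Sum>j=1..n. x j * g j)"

definition character :: "nat \<Rightarrow> nat \<Rightarrow> (nat \<Rightarrow> int) \<Rightarrow> (nat \<Rightarrow> int) \<Rightarrow> complex" where
  "character m n g x = exp (of_real pi * \<i> / of_nat m * of_int (pairing n x g))"

definition normalized_counting :: "nat \<Rightarrow> nat \<Rightarrow> (nat \<Rightarrow> int) measure" where
  "normalized_counting m n = uniform_count_measure (carrier (Zpow m n))"

definition Lp_norm :: "nat \<Rightarrow> nat \<Rightarrow> real \<Rightarrow> ((nat \<Rightarrow> int) \<Rightarrow> complex) \<Rightarrow> real" where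
  "Lp_norm m n p f = (LINT x|normalized_counting m n. norm (f x) powr p) powr (1 / p)"

definition fourier_coeff ::
  "nat \<Rightarrow> nat \<Rightarrow> ((nat \<Rightarrow> int) \<Rightarrow> complex) \<Rightarrow> (nat \<Rightarrow> int) \<Rightarrow> complex" where
  "fourier_coeff m n f g = (LINT x|normalized_counting m n. f x * cnj (character m n g x))"

definition multiplier ::
  "nat \<Rightarrow> nat \<Rightarrow> ((nat \<Rightarrow> int) \<Rightarrow> complex) \<Rightarrow> ((nat \<Rightarrow> int) \<Rightarrow> complex) \<Rightarrow> (nat \<Rightarrow> int) \<Rightarrow> complex" where
  "multiplier m n \<phi> f x =
     (\<Sum>g\<in>carrier (Zpow m n). \<phi> g * fourier_coeff m n f g * character m n g x)"

definition partial_deriv ::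
  "nat \<Rightarrow> nat \<Rightarrow> nat \<Rightarrow> ((nat \<Rightarrow> int) \<Rightarrow> complex) \<Rightarrow> (nat \<Rightarrow> int) \<Rightarrow> complex" where
  "partial_deriv m n j = multiplier m n (\<lambda>g. of_bool (g j \<noteq> 0))"

definition partial_u ::
  "nat \<Rightarrow> nat \<Rightarrow> nat \<Rightarrow> nat \<Rightarrow> ((nat \<Rightarrow> int) \<Rightarrow> complex) \<Rightarrow> (nat \<Rightarrow> int) \<Rightarrow> complex" where
  "partial_u m n j l =
     multiplier m n (\<lambda>g. 2 * of_real pi * \<i> * of_bool (int l \<le> g j \<and> g j < int l + int m))"

lemma carrier_Zpow: "m \<ge> 1 \<Longrightarrow> carrier (Zpow m n) = {1..n} \<rightarrow>\<^sub>E {0..<2 * int m}"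
  by (simp add: Zpow_def carrier_integer_mod_group)

lemma finite_carrier_Zpow: "m \<ge> 1 \<Longrightarrow> finite (carrier (Zpow m n))"
  by (simp add: carrier_Zpow finite_PiE)

lemma card_carrier_Zpow: "m \<ge> 1 \<Longrightarrow> card (carrier (Zpow m n)) = (2 * m) ^ n"
  by (simp add: carrier_Zpow card_PiE nat_mult_distrib)

lemma Lp_norm_eq:
  assumes "m \<ge> 1"
  shows "Lp_norm m n p f =
    ((\<Sum>x\<in>carrier (Zpow m n). norm (f x) powr p) / (2 * real m) ^ n) powr (1 / p)"
  using assms
  by (simp add: Lp_norm_def normalized_counting_def integral_uniform_count_measure
      finite_carrier_Zpow card_carrier_Zpow)

lemma fourier_coeff_eq:
  assumes "m \<ge> 1"
  shows "fourier_coeff m n f g =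
    (\<Sum>x\<in>carrier (Zpow m n). f x * cnj (character m n g x)) / (2 * of_nat m) ^ n"
proof -
  have "fourier_coeff m n f g = (\<Sum>x\<in>carrier (Zpow m n).
      (1 / real (card (carrier (Zpow m n)))) *\<^sub>R (f x * cnj (character m n g x)))"
    unfolding fourier_coeff_def normalized_counting_def uniform_count_measure_def
    by (rule lebesgue_integral_point_measure_finite)
       (use assms in \<open>simp_all add: finite_carrier_Zpow\<close>)
  also have "\<dots> = (\<Sum>x\<in>carrier (Zpow m n). f x * cnj (character m n g x)) / (2 * of_nat m) ^ n"
    using assms by (simp add: card_carrier_Zpow scaleR_conv_of_real sum_divide_distrib)
  finally show ?thesis .
qed

lemma character_commute: "character m n g x = character m n x g"
  by (simp add: character_def pairing_def mult.commute)

lemma sum_roots_of_unity_2m: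
  fixes z :: int
  assumes "m \<ge> 1" and "\<bar>z\<bar> < 2 * int m"
  shows "(\<Sum>a\<in>{0..<2 * int m}. exp (of_real pi * \<i> / of_nat m * of_int (a * z))) =
    (if z = 0 then 2 * of_nat m else 0 :: complex)"
proof (cases "z = 0")
  case True
  then show ?thesis using assms by simp
next
  case False
  define w :: complex where "w = exp (of_real pi * \<i> / of_nat m * of_int z)"
  have "(\<Sum>a\<in>{0..<2 * int m}. exp (of_real pi * \<i> / of_nat m * of_int (a * z))) =
      (\<Sum>k<2 * m. exp (of_real pi * \<i> / of_nat m * of_int (int k * z)))"
    by (rule sum.reindex_bij_witness[of _ int nat]) auto
  also have "\<dots> = (\<Sum>k<2 * m. w ^ k)"
    by (simp add: w_def exp_of_nat_mult[symmetric] mult_ac)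
  also have "\<dots> = 0"
  proof -
    have "w \<noteq> 1"
    proof
      assume "w = 1"
      then obtain q :: int where "pi / real m * real_of_int z = of_int (2 * q) * pi"
        unfolding w_def exp_eq_1 by auto
      then have "real_of_int z = real_of_int (2 * q * int m)"
        using assms by (simp add: field_simps)
      then have "z = 2 * int m * q" by (simp only: of_int_eq_iff) simp
      with assms(2) False show False
        by (metis dvd_triv_left zdvd_not_zless abs_of_nonneg abs_of_neg dvd_minus_iff
            linorder_not_less neg_0_less_iff_less order_less_le zero_less_abs_iff dvd_abs_iff)
    qed
    moreover have "w ^ (2 * m) = 1"
    proof -
      have "w ^ (2 * m) = exp (of_nat (2 * m) * (of_real pi * \<i> / of_nat m * of_int z))"
        by (simp only: w_def exp_of_nat_mult)
      also have "of_nat (2 * m) * (of_real pi * \<i> / of_nat m * of_int z) =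
          2 * of_int z * of_real pi * \<i>"
        using assms by (simp add: field_simps)
      also have "exp \<dots> = 1"
        by (simp add: exp_eq_1)
      finally show ?thesis .
    qed
    ultimately show ?thesis by (simp add: geometric_sum)
  qed
  finally show ?thesis using False by simp
qed

lemma character_orthogonal:
  assumes m: "m \<ge> 1" and x: "x \<in> carrier (Zpow m n)" and y: "y \<in> carrier (Zpow m n)"
  shows "(\<Sum>g\<in>carrier (Zpow m n). character m n g x * cnj (character m n g y)) =
    (if x = y then (2 * of_nat m) ^ n else 0)"
proof -
  have "character m n g x * cnj (character m n g y) =
      (\<Prod>j=1..n. exp (of_real pi * \<i> / of_nat m * of_int (g j * (x j - y j))))" for g
  proof -
    have "character m n g x * cnj (character m n g y) =
        exp (\<Sum>j=1..n. of_real pi * \<i> / of_nat m * of_int (g j * (x j - y j)))"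
      by (simp add: character_def pairing_def exp_cnj exp_add[symmetric] sum_distrib_left
          sum_subtractf[symmetric] sum_negf[symmetric] sum.distrib[symmetric] algebra_simps
          diff_divide_distrib)
    then show ?thesis by (simp add: exp_sum)
  qed
  then have "(\<Sum>g\<in>carrier (Zpow m n). character m n g x * cnj (character m n g y)) =
      (\<Sum>g\<in>{1..n} \<rightarrow>\<^sub>E {0..<2 * int m}.
        \<Prod>j=1..n. exp (of_real pi * \<i> / of_nat m * of_int (g j * (x j - y j))))"
    using m by (simp only: carrier_Zpow)
  also have "\<dots> = (\<Prod>j=1..n. \<Sum>a\<in>{0..<2 * int m}.
        exp (of_real pi * \<i> / of_nat m * of_int (a * (x j - y j))))"
    by (rule prod_sum_PiE[symmetric]) auto
  also have "\<dots> = (\<Prod>j=1..n. if x j = y j then 2 * of_nat m else 0)"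
  proof (rule prod.cong[OF refl])
    fix j assume "j \<in> {1..n}"
    then have "x j \<in> {0..<2 * int m}" "y j \<in> {0..<2 * int m}"
      using x y m by (auto simp: carrier_Zpow PiE_iff)
    then have "\<bar>x j - y j\<bar> < 2 * int m" by auto
    from sum_roots_of_unity_2m[OF m this]
    show "(\<Sum>a\<in>{0..<2 * int m}. exp (of_real pi * \<i> / of_nat m * of_int (a * (x j - y j)))) =
        (if x j = y j then 2 * of_nat m else 0 :: complex)" by simp
  qed
  also have "\<dots> = (if x = y then (2 * of_nat m) ^ n else 0)"
  proof (cases "x = y")
    case False
    then obtain j where "j \<in> {1..n}" "x j \<noteq> y j"
      using x y m PiE_ext[of x "{1..n}" _ y] by (metis carrier_Zpow)
    then show ?thesis using False by (auto intro!: prod_zero)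
  qed simp
  finally show ?thesis .
qed

lemma fourier_inversion:
  assumes m: "m \<ge> 1" and x: "x \<in> carrier (Zpow m n)"
  shows "f x = (\<Sum>g\<in>carrier (Zpow m n). fourier_coeff m n f g * character m n g x)"
proof -
  let ?G = "carrier (Zpow m n)"
  have "(\<Sum>g\<in>?G. fourier_coeff m n f g * character m n g x) =
      (\<Sum>g\<in>?G. \<Sum>y\<in>?G. f y * (character m n g x * cnj (character m n g y)) / (2 * of_nat m) ^ n)"
    using m by (simp add: fourier_coeff_eq sum_distrib_left sum_distrib_right sum_divide_distrib mult_ac)
  also have "\<dots> =
      (\<Sum>y\<in>?G. f y * (\<Sum>g\<in>?G. character m n g x * cnj (character m n g y)) / (2 * of_nat m) ^ n)"
    by (subst sum.swap) (simp add: sum_distrib_left sum_divide_distrib)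
  also have "\<dots> = (\<Sum>y\<in>?G. if x = y then f y else 0)"
    using m by (intro sum.cong refl) (simp add: character_orthogonal x)
  also have "\<dots> = f x"
    using x m by (simp add: finite_carrier_Zpow)
  finally show ?thesis by simp
qed

lemma fourier_coeff_character:
  assumes m: "m \<ge> 1" and g: "g \<in> carrier (Zpow m n)" and h: "h \<in> carrier (Zpow m n)"
  shows "fourier_coeff m n (character m n h) g = of_bool (g = h)"
  using character_orthogonal[OF m h g] m
  by (simp add: fourier_coeff_eq character_commute[of m n g] character_commute[of m n h])

lemma multiplier_character:
  assumes m: "m \<ge> 1" and g: "g \<in> carrier (Zpow m n)"
  shows "multiplier m n \<phi> (character m n g) x = \<phi> g * character m n g x"
proof -
  have "multiplier m n \<phi> (character m n g) x =
      (\<Sum>h\<in>carrier (Zpow m n). if h = g then \<phi> h * character m n h x else 0)"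
    unfolding multiplier_def
    by (intro sum.cong refl) (simp add: fourier_coeff_character[OF m _ g])
  also have "\<dots> = \<phi> g * character m n g x"
    using m g by (simp add: finite_carrier_Zpow)
  finally show ?thesis .
qed

end

theory Submission
  imports Defs
begin

text \<open>
  Let \<open>E\<^sub>S\<close> denote averaging over the coordinates outside \<open>S\<close>; it is the projection onto the frequencies
  supported in \<open>S\<close>. For a Bernoulli(\<open>\<delta>\<close>) random set \<open>S\<close>, the functions \<open>E\<^bsub>S \<inter> {1..j}\<^esub> f\<close>, \<open>j \<le> n\<close>, form a
  martingale for the joint filtration of \<open>(S \<inter> {1..j}, x\<^sub>1, \<dots>, x\<^sub>j)\<close>, with increments
  \<open>d\<^sub>j = E\<^bsub>S \<inter> {1..j}\<^esub> \<partial>\<^sub>j f\<close> if \<open>j \<in> S\<close> and \<open>0\<close> otherwise. A second-order Taylor bound for \<open>|a + d|\<^sup>p\<close> gives a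
  Rosenthal-type estimate. Its \<open>|d\<^sub>j|\<^sup>p\<close> part is at most \<open>\<delta> \<Sum> \<parallel>\<partial>\<^sub>j f\<parallel>\<^sup>p\<close>. Its quadratic part is, by Jensen, at most
  \<open>\<delta>\<close> times the expectation of (maximal function)\<open>\<^bsup>p-2\<^esup>\<close> times \<open>E\<^sub>S\<close> of the conditional square function of the
  single martingale \<open>E\<^bsub>{1..j}\<^esub> f\<close>, which is bounded in \<open>L\<^bsub>p/2\<^esub>\<close> by \<open>\<parallel>f\<parallel>\<^sub>p\<^sup>2\<close>; Doob's inequality and Young's
  inequality absorb the maximal function.

  Since \<open>\<parallel>E\<^sub>S f\<parallel>\<^sub>p\<close> increases with \<open>S\<close>, uniform \<open>k\<close>-subsets are dominated by Bernoulli(\<open>2k/n\<close>) sets via Chebyshev.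

  For the second inequality, \<open>\<partial>\<^bsub>u_j(1)\<^esub> + \<partial>\<^bsub>u_j(m)\<^esub> = 2\<pi>\<i> (\<partial>\<^sub>j + P)\<close> where \<open>P\<close> is the projection onto \<open>g\<^sub>j = m\<close>,
  a contraction of \<open>L\<^sub>p\<close>; so \<open>\<partial>\<^sub>j = (1 - P/2) (\<partial>\<^bsub>u_j(1)\<^esub> + \<partial>\<^bsub>u_j(m)\<^esub>) / (2\<pi>\<i>)\<close>.
\<close>

section \<open>Power inequalities\<close>

text \<open>By convexity the graph of \<open>t powr r\<close> lies above its tangent at
  \<open>a\<close>. The derivative is taken on the open half-line only, so zero arguments are
  treated separately; \<open>0 powr 0 = 0\<close> settles \<open>a = 0\<close>,
  \<open>r = 1\<close>.\<close>

lemma powr_tangent_le: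
  fixes a b r :: real
  assumes "1 \<le> r" "0 \<le> a" "0 \<le> b"
  shows "a powr r + r * a powr (r - 1) * (b - a) \<le> b powr r"
proof (cases "a = 0 \<or> b = 0")
  case True
  show ?thesis
  proof (cases "a = 0")
    case False
    then have "b = 0" using True by simp
    have "a * a powr (r - 1) = a powr r"
      using assms by (simp add: powr_mult_base)
    then have "a powr r + r * a powr (r - 1) * (b - a) = (1 - r) * a powr r"
      using \<open>b = 0\<close> by (simp add: algebra_simps)
    also have "\<dots> \<le> 0" using assms by (simp add: mult_le_0_iff)
    finally show ?thesis using \<open>b = 0\<close> by simp
  qed simp
next
  case False
  then have pos: "0 < a" "0 < b" using assms by auto
  have "b powr r - a powr r \<ge> r * a powr (r - 1) * (b - a)"
  proof (rule convex_on_imp_above_tangent[OF powr_convex[OF assms(1)]])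
    show "connected {0::real<..}" by simp
    show "a \<in> interior {0<..}" using pos by (simp add: interior_open)
    show "((\<lambda>x. x powr r) has_real_derivative r * a powr (r - 1)) (at a within {0<..})"
      using pos by (auto intro!: derivative_eq_intros simp: powr_diff)
  qed (use pos in auto)
  then show ?thesis by simp
qed

text \<open>A case split suffices: either \<open>v powr b\<close> is at most \<epsilon> times
  \<open>u powr b\<close> and the first term dominates, or \<open>u\<close> is at most a constant
  times \<open>v\<close> and the second does. A small \<epsilon> later allows absorption into the
  left side.\<close>

lemma powr_Young:
  fixes \<epsilon> a b :: real
  assumes "0 < \<epsilon>" "0 \<le> a" "0 < b"
  obtains C where "0 < C"
    and "\<And>u v. 0 \<le> u \<Longrightarrow> 0 \<le> v \<Longrightarrow>
      u powr a * v powr b \<le> \<epsilon> * u powr (a + b) + C * v powr (a + b)"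
proof
  define C where "C = (\<epsilon> powr (- 1 / b)) powr a"
  show "0 < C" using assms by (simp add: C_def)
  fix u v :: real
  assume uv: "0 \<le> u" "0 \<le> v"
  show "u powr a * v powr b \<le> \<epsilon> * u powr (a + b) + C * v powr (a + b)"
  proof (cases "v powr b \<le> \<epsilon> * u powr b")
    case True
    then have "u powr a * v powr b \<le> u powr a * (\<epsilon> * u powr b)"
      by (intro mult_left_mono) auto
    also have "\<dots> = \<epsilon> * u powr (a + b)" by (simp add: powr_add)
    finally show ?thesis using \<open>0 < C\<close> by (smt (verit) mult_nonneg_nonneg powr_ge_zero)
  next
    case False
    then have "u powr b \<le> v powr b / \<epsilon>" using assms by (simp add: field_simps)
    then have "(u powr b) powr (1 / b) \<le> (v powr b / \<epsilon>) powr (1 / b)"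
      using assms by (intro powr_mono2) auto
    then have "u \<le> v * \<epsilon> powr (- 1 / b)"
      using assms uv by (simp add: powr_powr powr_divide powr_minus field_simps)
    then have "u powr a \<le> (v * \<epsilon> powr (- 1 / b)) powr a"
      using assms uv by (intro powr_mono2) auto
    also have "\<dots> = C * v powr a" by (simp add: C_def powr_mult)
    finally have "u powr a * v powr b \<le> C * v powr a * v powr b"
      by (intro mult_right_mono) auto
    also have "\<dots> = C * v powr (a + b)" by (simp add: powr_add)
    finally show ?thesis using assms by (smt (verit) mult_nonneg_nonneg powr_ge_zero)
  qed
qed

text \<open>The factor \<open>b\<close> in front of the increment is what can be conditioned on in
  Doob's inequality. For \<open>a < b\<close> the claim says that
  \<open>a^p + b^p - 2 b a^(p-1)\<close> is nonnegative, and this is a sum of two nonnegative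
  terms.\<close>

lemma powr_running_max_step:
  fixes a b p :: real
  assumes "2 \<le> p" "0 \<le> a" "0 \<le> b"
  shows "max a b powr p \<le> a powr p + 2 * b * (max a b powr (p - 1) - a powr (p - 1))"
proof (cases "a < b")
  case True
  have "b * b powr (p - 1) = b powr p" "a * a powr (p - 1) = a powr p"
       "a * a powr (p - 2) = a powr (p - 1)" "b * b powr (p - 2) = b powr (p - 1)"
    using assms by (simp_all add: powr_mult_base)
  note e = this
  have m: "a powr (p - 2) \<le> b powr (p - 2)" using True assms by (intro powr_mono2) auto
  have "0 \<le> b * (b * (b powr (p - 2) - a powr (p - 2))) + (b - a)^2 * a powr (p - 2)"
    using m assms by (intro add_nonneg_nonneg mult_nonneg_nonneg) auto
  also have "\<dots> = b * (b * b powr (p - 2)) + a * (a * a powr (p - 2)) - 2 * b * (a * a powr (p - 2))"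
    by (simp add: algebra_simps power2_eq_square)
  also have "\<dots> = b powr p + a powr p - 2 * b * a powr (p - 1)"
    by (simp only: e)
  finally show ?thesis using True e by (simp add: max_def algebra_simps)
qed (simp add: max_def)

text \<open>Convexity is used twice: the tangent of \<open>t powr p\<close> at \<open>b\<close>
  bounds the Taylor remainder by a difference of derivatives times \<open>b - a\<close>, and the
  tangent of \<open>t powr (p - 1)\<close> at the larger point bounds that difference. The
  restriction on \<open>b - a\<close> keeps both points below \<open>2 * a\<close>.\<close>

lemma powr_second_order_pos:
  fixes a b p :: real
  assumes "2 \<le> p" "0 < a" "\<bar>b - a\<bar> \<le> a / 2"
  shows "b powr p \<le> a powr p + p * a powr (p - 1) * (b - a)
           + p * (p - 1) * 2 powr p * (a powr (p - 2) * (b - a)\<^sup>2)"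
proof -
  have b: "0 < b" "b \<le> 2 * a" using assms by linarith+
  have bnd: "(b powr (p - 1) - a powr (p - 1)) * (b - a) \<le> (p - 1) * (2 * a) powr (p - 2) * (b - a)\<^sup>2"
  proof (cases "a \<le> b")
    case True
    have "b powr (p - 1) - a powr (p - 1) \<le> (p - 1) * b powr (p - 2) * (b - a)"
      using powr_tangent_le[of "p - 1" b a] assms b by (simp add: algebra_simps)
    also have "\<dots> \<le> (p - 1) * (2 * a) powr (p - 2) * (b - a)"
      using True assms b by (intro mult_right_mono mult_left_mono powr_mono2) auto
    finally have "(b powr (p - 1) - a powr (p - 1)) * (b - a) \<le> \<dots> * (b - a)"
      using True by (intro mult_right_mono) auto
    then show ?thesis by (simp add: power2_eq_square mult.assoc)
  next
    case False
    have "a powr (p - 1) - b powr (p - 1) \<le> (p - 1) * a powr (p - 2) * (a - b)"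
      using powr_tangent_le[of "p - 1" a b] assms b by (simp add: algebra_simps)
    also have "\<dots> \<le> (p - 1) * (2 * a) powr (p - 2) * (a - b)"
      using False assms b by (intro mult_right_mono mult_left_mono powr_mono2) auto
    finally have "(a powr (p - 1) - b powr (p - 1)) * (a - b) \<le> \<dots> * (a - b)"
      using False by (intro mult_right_mono) auto
    then show ?thesis by (simp add: power2_eq_square algebra_simps)
  qed
  have "b powr p - a powr p - p * a powr (p - 1) * (b - a) \<le> p * ((b powr (p - 1) - a powr (p - 1)) * (b - a))"
    using powr_tangent_le[of p b a] assms b by (simp add: algebra_simps)
  also have "\<dots> \<le> p * ((p - 1) * (2 * a) powr (p - 2) * (b - a)\<^sup>2)"
    using bnd assms by (intro mult_left_mono) auto
  also have "\<dots> = p * (p - 1) * 2 powr (p - 2) * (a powr (p - 2) * (b - a)\<^sup>2)"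
    by (simp add: powr_mult)
  also have "\<dots> \<le> p * (p - 1) * 2 powr p * (a powr (p - 2) * (b - a)\<^sup>2)"
    using assms by (intro mult_right_mono mult_left_mono) auto
  finally show ?thesis by simp
qed

text \<open>The Taylor bound covers \<open>\<bar>d\<bar> \<le> \<bar>a\<bar> / 2\<close>. Otherwise
  \<open>\<bar>a\<bar> \<le> 2 * \<bar>d\<bar>\<close> and only \<open>\<bar>d\<bar> powr p\<close>
  matters: \<open>3 powr p\<close> comes from
  \<open>\<bar>a + d\<bar> \<le> 3 * \<bar>d\<bar>\<close>, and \<open>p * 2 powr (p - 1)\<close>
  pays for a negative first-order term.\<close>

lemma powr_second_order:
  fixes p :: real
  assumes p: "2 \<le> p"
  obtains C where "0 < C"
    and "\<And>a d. \<bar>a + d\<bar> powr p \<le> \<bar>a\<bar> powr p + p * (sgn a * \<bar>a\<bar> powr (p - 1)) * d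
           + C * (\<bar>a\<bar> powr (p - 2) * d\<^sup>2 + \<bar>d\<bar> powr p)"
proof
  let ?C1 = "p * (p - 1) * 2 powr p" and ?C2 = "3 powr p + p * 2 powr (p - 1)"
  define C where "C = ?C1 + ?C2"
  have C: "?C1 \<le> C" "?C2 \<le> C" using p by (auto simp: C_def intro!: add_nonneg_nonneg)
  show "0 < C" using p by (auto simp: C_def intro!: add_pos_nonneg add_nonneg_pos)
  fix a d :: real
  let ?R = "\<bar>a\<bar> powr (p - 2) * d\<^sup>2"
  have R: "0 \<le> ?R" by simp
  show "\<bar>a + d\<bar> powr p \<le> \<bar>a\<bar> powr p + p * (sgn a * \<bar>a\<bar> powr (p - 1)) * d + C * (?R + \<bar>d\<bar> powr p)"
  proof (cases "\<bar>d\<bar> \<le> \<bar>a\<bar> / 2 \<and> a \<noteq> 0")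
    case True
    have *: "\<bar>a + d\<bar> powr p \<le> \<bar>a\<bar> powr p + p * (sgn a * \<bar>a\<bar> powr (p - 1)) * d + ?C1 * ?R"
    proof (cases "a > 0")
      case True': True
      have "(a + d) powr p \<le> a powr p + p * a powr (p - 1) * d + ?C1 * (a powr (p - 2) * d\<^sup>2)"
        using powr_second_order_pos[OF p True', of "a + d"] True True' by simp
      then show ?thesis using True True' by (simp add: abs_if split: if_splits)
    next
      case False
      have "(- a - d) powr p \<le> (- a) powr p + p * (- a) powr (p - 1) * (- d) + ?C1 * ((- a) powr (p - 2) * d\<^sup>2)"
        using powr_second_order_pos[OF p, of "- a" "- a - d"] True False by simp
      moreover have "\<bar>a + d\<bar> = - a - d" "\<bar>a\<bar> = - a" "sgn a = -1" using True False by auto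
      ultimately show ?thesis by (simp only: mult_minus_left mult_minus_right mult_1_left minus_mult_minus power2_minus)
    qed
    have "?C1 * ?R \<le> C * ?R" using C R by (intro mult_right_mono)
    moreover have "0 \<le> C * \<bar>d\<bar> powr p" using \<open>0 < C\<close> by simp
    ultimately show ?thesis using * by (simp add: distrib_left)
  next
    case False
    then have ad: "\<bar>a\<bar> \<le> 2 * \<bar>d\<bar>" by auto
    have "\<bar>a + d\<bar> powr p \<le> (3 * \<bar>d\<bar>) powr p"
      using ad p by (intro powr_mono2) auto
    then have 1: "\<bar>a + d\<bar> powr p \<le> 3 powr p * \<bar>d\<bar> powr p" by (simp only: powr_mult)
    have "- (sgn a * d) \<le> \<bar>d\<bar>" by (auto simp: sgn_if)
    then have "\<bar>a\<bar> powr (p - 1) * (- (sgn a * d)) \<le> (2 * \<bar>d\<bar>) powr (p - 1) * \<bar>d\<bar>"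
      using ad p by (smt (verit) mult_mono' mult_left_mono powr_ge_zero powr_mono2 abs_ge_zero)
    also have "\<dots> = 2 powr (p - 1) * (\<bar>d\<bar> * \<bar>d\<bar> powr (p - 1))" by (simp only: powr_mult mult_ac)
    also have "\<bar>d\<bar> * \<bar>d\<bar> powr (p - 1) = \<bar>d\<bar> powr p" by (subst powr_mult_base) auto
    finally have "p * (\<bar>a\<bar> powr (p - 1) * (- (sgn a * d))) \<le> p * (2 powr (p - 1) * \<bar>d\<bar> powr p)"
      using p by (intro mult_left_mono) auto
    then have "\<bar>a + d\<bar> powr p \<le> \<bar>a\<bar> powr p + p * (sgn a * \<bar>a\<bar> powr (p - 1)) * d + ?C2 * \<bar>d\<bar> powr p"
      using 1 by (smt (verit) distrib_right mult.assoc mult.commute mult_minus_left mult_minus_right powr_ge_zero)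
    moreover have "?C2 * \<bar>d\<bar> powr p \<le> C * \<bar>d\<bar> powr p" using C by (intro mult_right_mono) auto
    moreover have "0 \<le> C * ?R" using \<open>0 < C\<close> R by simp
    ultimately show ?thesis by (simp add: distrib_left)
  qed
qed

section \<open>Conditional averages on a finite product\<close>

locale finite_product =
  fixes n :: nat and B :: "'b set"
  assumes finite_B: "finite B" and nonempty_B: "B \<noteq> {}"
begin

definition \<Omega> :: "(nat \<Rightarrow> 'b) set" where
  "\<Omega> = {1..n} \<rightarrow>\<^sub>E B"

definition merge :: "nat set \<Rightarrow> (nat \<Rightarrow> 'b) \<Rightarrow> (nat \<Rightarrow> 'b) \<Rightarrow> nat \<Rightarrow> 'b" where
  "merge S x y = (\<lambda>i. if i \<in> S then x i else y i)"

definition mean :: "((nat \<Rightarrow> 'b) \<Rightarrow> 'c::real_normed_field) \<Rightarrow> 'c" where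
  "mean f = (\<Sum>x\<in>\<Omega>. f x) / of_nat (card \<Omega>)"

text \<open>Conditional expectation is encoded as resampling the coordinates outside
  \<open>S\<close> from an independent uniform point, so that composition reduces to the algebra of
  \<open>merge\<close>.\<close>

definition cexp :: "nat set \<Rightarrow> ((nat \<Rightarrow> 'b) \<Rightarrow> 'c::real_normed_field) \<Rightarrow> (nat \<Rightarrow> 'b) \<Rightarrow> 'c" where
  "cexp S f x = mean (\<lambda>y. f (merge S x y))"

text \<open>On \<open>\<Omega>\<close>, the function \<open>g\<close> depends only on the coordinates in \<open>S\<close>.\<close>

definition meas :: "nat set \<Rightarrow> ((nat \<Rightarrow> 'b) \<Rightarrow> 'c) \<Rightarrow> bool" where
  "meas S g \<longleftrightarrow> (\<forall>x\<in>\<Omega>. \<forall>y\<in>\<Omega>. g (merge S x y) = g x)"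

lemma finite_\<Omega>: "finite \<Omega>"
  by (simp add: \<Omega>_def finite_PiE finite_B)

lemma \<Omega>_nonempty: "\<Omega> \<noteq> {}"
  by (simp add: \<Omega>_def PiE_eq_empty_iff nonempty_B)

lemma card_\<Omega>_pos: "0 < card \<Omega>"
  using finite_\<Omega> \<Omega>_nonempty by (simp add: card_gt_0_iff)

lemma merge_in [simp]: "x \<in> \<Omega> \<Longrightarrow> y \<in> \<Omega> \<Longrightarrow> merge S x y \<in> \<Omega>"
  by (auto simp: \<Omega>_def merge_def PiE_iff extensional_def)

lemma mean_cong: "(\<And>x. x \<in> \<Omega> \<Longrightarrow> f x = g x) \<Longrightarrow> mean f = mean g"
  by (simp add: mean_def cong: sum.cong)

lemma mean_add: "mean (\<lambda>x. f x + g x) = mean f + mean g"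
  by (simp add: mean_def sum.distrib add_divide_distrib)

lemma mean_diff: "mean (\<lambda>x. f x - g x) = mean f - mean g"
  by (simp add: mean_def sum_subtractf diff_divide_distrib)

lemma mean_cmult: "mean (\<lambda>x. c * f x) = c * mean f"
  by (simp add: mean_def sum_distrib_left)

lemma mean_const [simp]: "mean (\<lambda>x. c) = c"
  using card_\<Omega>_pos by (simp add: mean_def)

lemma mean_sum: "mean (\<lambda>x. \<Sum>i\<in>A. f i x) = (\<Sum>i\<in>A. mean (f i))"
  by (simp add: mean_def sum.swap[of _ A] sum_divide_distrib)

lemma mean_mono:
  fixes f g :: "(nat \<Rightarrow> 'b) \<Rightarrow> real"
  shows "(\<And>x. x \<in> \<Omega> \<Longrightarrow> f x \<le> g x) \<Longrightarrow> mean f \<le> mean g"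
  by (auto simp: mean_def intro!: divide_right_mono sum_mono)

lemma mean_nonneg:
  fixes f :: "(nat \<Rightarrow> 'b) \<Rightarrow> real"
  shows "(\<And>x. x \<in> \<Omega> \<Longrightarrow> 0 \<le> f x) \<Longrightarrow> 0 \<le> mean f"
  using mean_mono[of "\<lambda>_. 0" f] by simp

lemma norm_mean_le: "norm (mean f) \<le> mean (\<lambda>x. norm (f x))"
  by (auto simp: mean_def norm_divide intro!: divide_right_mono norm_sum)

text \<open>Exchanging the coordinates outside \<open>T\<close> between two independent points is an
  involution of the pairs, hence preserves the uniform measure.\<close>

lemma mean_merge:
  "mean (\<lambda>y. mean (\<lambda>z. h (merge T y z))) = mean h"
proof -
  let ?c = "of_nat (card \<Omega>) :: 'a"
  have "(\<Sum>y\<in>\<Omega>. \<Sum>z\<in>\<Omega>. h (merge T y z)) = (\<Sum>(y, z)\<in>\<Omega> \<times> \<Omega>. h (merge T y z))"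
    by (simp add: sum.cartesian_product)
  also have "\<dots> = (\<Sum>(w, v)\<in>\<Omega> \<times> \<Omega>. h w)"
    by (rule sum.reindex_bij_witness[of _ "\<lambda>(y, z). (merge T y z, merge T z y)"
          "\<lambda>(y, z). (merge T y z, merge T z y)"])
       (auto simp: \<Omega>_def merge_def fun_eq_iff PiE_iff extensional_def)
  also have "\<dots> = ?c * (\<Sum>w\<in>\<Omega>. h w)"
    by (simp add: sum.cartesian_product[symmetric] sum_distrib_left)
  finally show ?thesis
    using card_\<Omega>_pos by (simp add: mean_def sum_divide_distrib[symmetric])
qed

lemma mean_cexp: "mean (cexp S f) = mean f"
  unfolding cexp_def by (rule mean_merge)

text \<open>Two nested resamplings keep of \<open>x\<close> only the coordinates in both sets, and
  the fresh point \<open>merge T y z\<close> is again uniform by \<open>mean_merge\<close>.\<close>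

lemma cexp_cexp: "cexp S (cexp T f) x = cexp (S \<inter> T) f x"
proof -
  have "merge T (merge S x y) z = merge (S \<inter> T) x (merge T y z)" for y z
    by (auto simp: merge_def)
  then have "cexp S (cexp T f) x =
      mean (\<lambda>y. mean (\<lambda>z. f (merge (S \<inter> T) x (merge T y z))))"
    by (simp add: cexp_def)
  also have "\<dots> = cexp (S \<inter> T) f x"
    by (simp only: mean_merge[of "\<lambda>w. f (merge (S \<inter> T) x w)"] cexp_def)
  finally show ?thesis .
qed

lemma cexp_cexp': "cexp S (cexp T f) = cexp (S \<inter> T) f"
  by (rule ext) (rule cexp_cexp)

lemma cexp_all: "{1..n} \<subseteq> S \<Longrightarrow> x \<in> \<Omega> \<Longrightarrow> cexp S f x = f x"
proof -
  assume "{1..n} \<subseteq> S" "x \<in> \<Omega>"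
  have "merge S x y = x" if "y \<in> \<Omega>" for y
  proof (rule ext)
    fix i
    show "merge S x y i = x i"
    proof (cases "i \<in> {1..n}")
      case True
      then show ?thesis using \<open>{1..n} \<subseteq> S\<close> by (auto simp: merge_def)
    next
      case False
      then show ?thesis
        using PiE_arb[of x "{1..n}" "\<lambda>_. B" i] PiE_arb[of y "{1..n}" "\<lambda>_. B" i] that \<open>x \<in> \<Omega>\<close>
        by (simp add: merge_def \<Omega>_def)
    qed
  qed
  then have "mean (\<lambda>y. f (merge S x y)) = mean (\<lambda>y. f x)" by (intro mean_cong) simp
  then show ?thesis by (simp add: cexp_def)
qed

lemma cexp_empty: "cexp {} f x = mean f"
  by (simp add: cexp_def merge_def)

lemma cexp_cong: "(\<And>x. x \<in> \<Omega> \<Longrightarrow> f x = g x) \<Longrightarrow> x \<in> \<Omega> \<Longrightarrow> cexp S f x = cexp S g x"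
  unfolding cexp_def by (intro mean_cong) simp

lemma cexp_diff: "cexp S (\<lambda>x. f x - g x) x = cexp S f x - cexp S g x"
  by (simp add: cexp_def mean_diff)

lemma cexp_cmult: "cexp S (\<lambda>x. c * f x) x = c * cexp S f x"
  by (simp add: cexp_def mean_cmult)

lemma cexp_sum: "cexp S (\<lambda>x. \<Sum>i\<in>A. f i x) x = (\<Sum>i\<in>A. cexp S (f i) x)"
  by (simp add: cexp_def mean_sum)

lemma cexp_nonneg:
  fixes f :: "(nat \<Rightarrow> 'b) \<Rightarrow> real"
  shows "(\<And>x. x \<in> \<Omega> \<Longrightarrow> 0 \<le> f x) \<Longrightarrow> x \<in> \<Omega> \<Longrightarrow> 0 \<le> cexp S f x"
  unfolding cexp_def by (intro mean_nonneg) simp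

lemma norm_cexp_le: "norm (cexp S f x) \<le> cexp S (\<lambda>y. norm (f y)) x"
  unfolding cexp_def by (rule norm_mean_le)

text \<open>Averaging the tangent inequality at the point \<open>mean f\<close> removes its linear
  term.\<close>

lemma mean_powr_Jensen:
  fixes f :: "(nat \<Rightarrow> 'b) \<Rightarrow> real"
  assumes r: "1 \<le> r" and f: "\<And>x. x \<in> \<Omega> \<Longrightarrow> 0 \<le> f x"
  shows "mean f powr r \<le> mean (\<lambda>x. f x powr r)"
proof -
  let ?a = "mean f"
  have "?a powr r = mean (\<lambda>x. ?a powr r + r * ?a powr (r - 1) * (f x - ?a))"
    by (simp add: mean_add mean_cmult mean_diff)
  also have "\<dots> \<le> mean (\<lambda>x. f x powr r)"
    by (intro mean_mono powr_tangent_le r f mean_nonneg)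
  finally show ?thesis .
qed

lemma cexp_powr_Jensen:
  fixes f :: "(nat \<Rightarrow> 'b) \<Rightarrow> real"
  assumes "1 \<le> r" "\<And>x. x \<in> \<Omega> \<Longrightarrow> 0 \<le> f x" "x \<in> \<Omega>"
  shows "cexp S f x powr r \<le> cexp S (\<lambda>x. f x powr r) x"
  unfolding cexp_def using assms by (intro mean_powr_Jensen) auto

lemma norm_cexp_powr_le:
  assumes "1 \<le> r" "x \<in> \<Omega>"
  shows "norm (cexp S f x) powr r \<le> cexp S (\<lambda>y. norm (f y) powr r) x"
proof -
  have "norm (cexp S f x) powr r \<le> cexp S (\<lambda>y. norm (f y)) x powr r"
    using assms by (intro powr_mono2 norm_cexp_le) auto
  also have "\<dots> \<le> cexp S (\<lambda>y. norm (f y) powr r) x"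
    using assms by (intro cexp_powr_Jensen) auto
  finally show ?thesis .
qed

lemma mean_norm_cexp_powr_le:
  assumes "1 \<le> r"
  shows "mean (\<lambda>x. norm (cexp S f x) powr r) \<le> mean (\<lambda>x. norm (f x) powr r)"
proof -
  have "mean (\<lambda>x. norm (cexp S f x) powr r) \<le> mean (cexp S (\<lambda>y. norm (f y) powr r))"
    by (intro mean_mono norm_cexp_powr_le assms)
  then show ?thesis by (simp add: mean_cexp)
qed

lemma meas_cexp [simp]: "meas S (cexp S f)"
  by (auto simp: meas_def cexp_def merge_def cong: if_cong)

lemma meas_mono: "meas S g \<Longrightarrow> S \<subseteq> T \<Longrightarrow> meas T g"
proof (unfold meas_def, intro ballI)
  fix x y
  assume g: "\<forall>x\<in>\<Omega>. \<forall>y\<in>\<Omega>. g (merge S x y) = g x" and ST: "S \<subseteq> T" and xy: "x \<in> \<Omega>" "y \<in> \<Omega>"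
  have "merge S (merge T x y) y = merge S x y" using ST by (auto simp: merge_def fun_eq_iff)
  then show "g (merge T x y) = g x" using g xy by (metis merge_in)
qed

lemma meas_comp: "meas S g \<Longrightarrow> meas S (\<lambda>x. \<phi> (g x))"
  by (simp add: meas_def)

lemma meas_comp2: "meas S g \<Longrightarrow> meas S h \<Longrightarrow> meas S (\<lambda>x. \<phi> (g x) (h x))"
  by (simp add: meas_def)

lemma meas_sum: "(\<And>i. i \<in> A \<Longrightarrow> meas S (f i)) \<Longrightarrow> meas S (\<lambda>x. \<Sum>i\<in>A. f i x)"
  by (simp add: meas_def)

lemma cexp_pull_out:
  assumes "meas S g" "x \<in> \<Omega>"
  shows "cexp S (\<lambda>x. g x * h x) x = g x * cexp S h x"
proof -
  have "mean (\<lambda>y. g (merge S x y) * h (merge S x y)) = mean (\<lambda>y. g x * h (merge S x y))"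
    using assms by (intro mean_cong) (simp add: meas_def)
  then show ?thesis by (simp add: cexp_def mean_cmult)
qed

lemma mean_mult_cexp:
  assumes "meas S g"
  shows "mean (\<lambda>x. g x * cexp S h x) = mean (\<lambda>x. g x * h x)"
proof -
  have "mean (\<lambda>x. g x * h x) = mean (cexp S (\<lambda>x. g x * h x))" by (simp add: mean_cexp)
  also have "\<dots> = mean (\<lambda>x. g x * cexp S h x)" by (intro mean_cong cexp_pull_out assms)
  finally show ?thesis by simp
qed

text \<open>The submartingale property of absolute values, tested against nonnegative weights that
  depend on the coordinates in \<open>S\<close>.\<close>

lemma mean_mult_cexp_mono:
  fixes g h :: "(nat \<Rightarrow> 'b) \<Rightarrow> real"
  assumes "meas S g" "\<And>x. x \<in> \<Omega> \<Longrightarrow> 0 \<le> g x"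
  shows "mean (\<lambda>x. \<bar>cexp S h x\<bar> * g x) \<le> mean (\<lambda>x. \<bar>h x\<bar> * g x)"
proof -
  have "mean (\<lambda>x. \<bar>cexp S h x\<bar> * g x) \<le> mean (\<lambda>x. g x * cexp S (\<lambda>y. \<bar>h y\<bar>) x)"
    using assms norm_cexp_le[of S h]
    by (intro mean_mono) (auto simp: mult.commute intro!: mult_left_mono)
  then show ?thesis by (simp add: mean_mult_cexp[OF assms(1)] mult.commute)
qed

section \<open>Running maxima and Doob's inequality\<close>

primrec run_max :: "(nat \<Rightarrow> (nat \<Rightarrow> 'b) \<Rightarrow> real) \<Rightarrow> nat \<Rightarrow> (nat \<Rightarrow> 'b) \<Rightarrow> real" where
  "run_max X 0 x = X 0 x"
| "run_max X (Suc j) x = max (run_max X j x) (X (Suc j) x)"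

lemma run_max_ge: "i \<le> j \<Longrightarrow> X i x \<le> run_max X j x"
  by (induction j) (auto simp: le_Suc_eq)

lemma run_max_nonneg: "(\<And>i. 0 \<le> X i x) \<Longrightarrow> 0 \<le> run_max X j x"
  by (induction j) (auto simp: le_max_iff_disj)

lemma run_max_meas:
  assumes "\<And>i. i \<le> j \<Longrightarrow> meas S (X i)"
  shows "meas S (run_max X j)"
  using assms
proof (induction j)
  case (Suc j)
  then show ?case using meas_comp2[of S "run_max X j" "X (Suc j)" max] by simp
qed (simp add: meas_def)

text \<open>
  Here and below the constants enter as hypotheses (instances of \<open>powr_Young\<close>), so that they visibly do not
  depend on \<open>n\<close> and \<open>B\<close>.
\<close>

lemma Doob_maximal:
  fixes p :: real
  assumes p: "2 \<le> p"
    and young: "\<And>u v. 0 \<le> u \<Longrightarrow> 0 \<le> v \<Longrightarrow> u powr (p - 1) * v \<le> 1/4 * u powr p + C * v powr p"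
    and A: "mono A"
  shows "mean (\<lambda>x. run_max (\<lambda>j x. \<bar>cexp (A j) f x\<bar>) N x powr p) \<le> 4 * C * mean (\<lambda>x. \<bar>cexp (A N) f x\<bar> powr p)"
proof -
  let ?X = "\<lambda>j x. \<bar>cexp (A j) f x\<bar>"
  let ?h = "?X N"
  let ?M = "run_max ?X"
  have X_le: "mean (\<lambda>x. ?X j x * g x) \<le> mean (\<lambda>x. ?h x * g x)"
    if "j \<le> N" "meas (A j) g" "\<And>x. x \<in> \<Omega> \<Longrightarrow> 0 \<le> g x" for j g
    using mean_mult_cexp_mono[OF that(2,3), of "cexp (A N) f"] monoD[OF A that(1)]
    by (simp add: cexp_cexp' Int_absorb2)
  have M_nonneg: "0 \<le> ?M j x" for j x by (intro run_max_nonneg) simp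
  have M_meas: "meas (A j) (?M i)" if "i \<le> j" for i j
    using that A by (intro run_max_meas) (auto intro!: meas_comp[of _ _ abs] meas_mono[OF meas_cexp] dest: monoD)
  \<comment> \<open>By \<open>powr_running_max_step\<close> each increment of the p-th power is
    \<open>?X (Suc j)\<close> times a weight that depends on \<open>A (Suc j)\<close> only. So
    \<open>?X (Suc j)\<close> may be replaced by the terminal value \<open>?h\<close>, and the
    bounds telescope.\<close>
  have step: "mean (\<lambda>x. ?M j x powr p) \<le> 2 * mean (\<lambda>x. ?h x * ?M j x powr (p - 1))" if "j \<le> N" for j
    using that
  proof (induction j)
    case 0
    have "mean (\<lambda>x. ?M 0 x powr p) = mean (\<lambda>x. ?X 0 x * ?M 0 x powr (p - 1))"
      by (simp add: powr_mult_base)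
    also have "\<dots> \<le> mean (\<lambda>x. ?h x * ?M 0 x powr (p - 1))"
      using 0 by (intro X_le meas_comp[OF M_meas, of _ _ "\<lambda>u. u powr (p - 1)"]) auto
    also have "\<dots> \<le> 2 * \<dots>" by (simp add: mean_nonneg)
    finally show ?case .
  next
    case (Suc j)
    let ?D = "\<lambda>x. ?M (Suc j) x powr (p - 1) - ?M j x powr (p - 1)"
    have D: "0 \<le> ?D x" for x
      using p M_nonneg[of j x] powr_mono2[of "p - 1" "?M j x" "?M (Suc j) x"] by simp
    have "mean (\<lambda>x. ?M (Suc j) x powr p) \<le> mean (\<lambda>x. ?M j x powr p + 2 * (?X (Suc j) x * ?D x))"
    proof (intro mean_mono)
      fix x
      show "?M (Suc j) x powr p \<le> ?M j x powr p + 2 * (?X (Suc j) x * ?D x)"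
        using powr_running_max_step[OF p M_nonneg[of j x], of "?X (Suc j) x"] by (simp add: mult.assoc)
    qed
    also have "\<dots> = mean (\<lambda>x. ?M j x powr p) + 2 * mean (\<lambda>x. ?X (Suc j) x * ?D x)"
      by (simp only: mean_add mean_cmult)
    also have "mean (\<lambda>x. ?X (Suc j) x * ?D x) \<le> mean (\<lambda>x. ?h x * ?D x)"
    proof (intro X_le D)
      show "meas (A (Suc j)) ?D"
        using meas_comp2[OF M_meas[of "Suc j" "Suc j"] M_meas[of j "Suc j"],
            of "\<lambda>u v. u powr (p - 1) - v powr (p - 1)"] by simp
    qed (use Suc in auto)
    also have "\<dots> = mean (\<lambda>x. ?h x * ?M (Suc j) x powr (p - 1)) - mean (\<lambda>x. ?h x * ?M j x powr (p - 1))"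
      by (simp only: right_diff_distrib mean_diff)
    finally show ?case using Suc by simp
  qed
  have "mean (\<lambda>x. ?M N x powr p) \<le> 2 * mean (\<lambda>x. ?h x * ?M N x powr (p - 1))" by (rule step) simp
  \<comment> \<open>The coefficient 1/4 leaves half of the left side on the right, where it is
    absorbed.\<close>
  also have "\<dots> \<le> 2 * mean (\<lambda>x. 1/4 * ?M N x powr p + C * ?h x powr p)"
  proof (intro mult_left_mono mean_mono)
    fix x
    show "?h x * ?M N x powr (p - 1) \<le> 1/4 * ?M N x powr p + C * ?h x powr p"
      using young[OF M_nonneg[of N x], of "?h x"] by (simp add: mult.commute)
  qed simp
  also have "\<dots> = 1/2 * mean (\<lambda>x. ?M N x powr p) + 2 * C * mean (\<lambda>x. ?h x powr p)"
    by (simp only: mean_add mean_cmult) simp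
  finally show "mean (\<lambda>x. ?M N x powr p) \<le> 4 * C * mean (\<lambda>x. ?h x powr p)" by simp
qed

end

section \<open>Bernoulli random coordinate sets\<close>

text \<open>The expectation of \<open>g S\<close> for a random \<open>S \<subseteq> {1..j}\<close> containing each index independently with probability \<open>\<delta>\<close>.\<close>

primrec bernoulli_sum :: "real \<Rightarrow> nat \<Rightarrow> (nat set \<Rightarrow> real) \<Rightarrow> real" where
  "bernoulli_sum \<delta> 0 g = g {}"
| "bernoulli_sum \<delta> (Suc j) g =
     (1 - \<delta>) * bernoulli_sum \<delta> j g + \<delta> * bernoulli_sum \<delta> j (\<lambda>S. g (insert (Suc j) S))"

lemma insert_Suc_subset: "S \<subseteq> {1..j} \<Longrightarrow> insert (Suc j) S \<subseteq> {1..Suc j}" for j :: nat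
  by auto

lemma subset_Suc: "S \<subseteq> {1..j} \<Longrightarrow> S \<subseteq> {1..Suc j}" for j :: nat
  by auto

lemma bernoulli_sum_mono:
  assumes "0 \<le> \<delta>" "\<delta> \<le> 1" "\<And>S. S \<subseteq> {1..j} \<Longrightarrow> g S \<le> h S"
  shows "bernoulli_sum \<delta> j g \<le> bernoulli_sum \<delta> j h"
  using assms(3)
proof (induction j arbitrary: g h)
  case (Suc j)
  have "bernoulli_sum \<delta> j g \<le> bernoulli_sum \<delta> j h"
    by (intro Suc.IH Suc.prems subset_Suc)
  moreover have "bernoulli_sum \<delta> j (\<lambda>S. g (insert (Suc j) S)) \<le> bernoulli_sum \<delta> j (\<lambda>S. h (insert (Suc j) S))"
    by (intro Suc.IH Suc.prems insert_Suc_subset)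
  ultimately show ?case using assms(1,2) by (auto intro!: add_mono mult_left_mono)
qed simp

lemma bernoulli_sum_cong:
  "(\<And>S. S \<subseteq> {1..j} \<Longrightarrow> g S = h S) \<Longrightarrow> bernoulli_sum \<delta> j g = bernoulli_sum \<delta> j h"
proof (induction j arbitrary: g h)
  case (Suc j)
  have "bernoulli_sum \<delta> j g = bernoulli_sum \<delta> j h"
    by (intro Suc.IH Suc.prems subset_Suc)
  moreover have "bernoulli_sum \<delta> j (\<lambda>S. g (insert (Suc j) S)) = bernoulli_sum \<delta> j (\<lambda>S. h (insert (Suc j) S))"
    by (intro Suc.IH Suc.prems insert_Suc_subset)
  ultimately show ?case by simp
qed simp

lemma bernoulli_sum_add:
  "bernoulli_sum \<delta> j (\<lambda>S. g S + h S) = bernoulli_sum \<delta> j g + bernoulli_sum \<delta> j h"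
  by (induction j arbitrary: g h) (simp_all add: algebra_simps)

lemma bernoulli_sum_cmult: "bernoulli_sum \<delta> j (\<lambda>S. c * g S) = c * bernoulli_sum \<delta> j g"
  by (induction j arbitrary: g) (simp_all add: algebra_simps)

lemma bernoulli_sum_const: "bernoulli_sum \<delta> j (\<lambda>S. c) = c"
  by (induction j) (simp_all add: algebra_simps)

lemma bernoulli_sum_sum:
  "bernoulli_sum \<delta> j (\<lambda>S. \<Sum>i<N. g i S) = (\<Sum>i<(N::nat). bernoulli_sum \<delta> j (g i))"
  by (induction N) (simp_all add: bernoulli_sum_const bernoulli_sum_add)

text \<open>Choices after time \<open>j\<close> do not affect the integrand and their probabilities
  sum to 1. This gathers expectations over different index ranges into one over subsets of
  \<open>{1..N}\<close>.\<close>

lemma bernoulli_sum_Int: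
  assumes "j \<le> N"
  shows "bernoulli_sum \<delta> N (\<lambda>S. g (S \<inter> {1..j})) = bernoulli_sum \<delta> j g"
  using assms
proof (induction N)
  case (Suc N)
  show ?case
  proof (cases "j = Suc N")
    case True
    have "bernoulli_sum \<delta> (Suc N) (\<lambda>S. g (S \<inter> {1..Suc N})) = bernoulli_sum \<delta> (Suc N) g"
      by (intro bernoulli_sum_cong) (simp only: Int_absorb2)
    then show ?thesis unfolding True .
  next
    case False
    then have "j \<le> N" using Suc by simp
    then have "insert (Suc N) S \<inter> {1..j} = S \<inter> {1..j}" for S by auto
    then show ?thesis using Suc.IH[OF \<open>j \<le> N\<close>] by (simp add: algebra_simps)
  qed
qed simp

text \<open>The indices are revealed one at a time. Step \<open>Suc j\<close> changes \<Phi> only if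
  \<open>Suc j\<close> is selected, and this event supplies the factor \<delta>.\<close>

lemma bernoulli_sum_telescope:
  assumes "0 \<le> \<delta>" "\<delta> \<le> 1"
    and incr: "\<And>j S. j < N \<Longrightarrow> S \<subseteq> {1..j} \<Longrightarrow> \<Phi> (insert (Suc j) S) \<le> \<Phi> S + C * (G j S + b j)"
  shows "bernoulli_sum \<delta> N \<Phi> \<le> \<Phi> {} + C * \<delta> * (\<Sum>j<N. bernoulli_sum \<delta> j (G j) + b j)"
  using incr
proof (induction N)
  case (Suc N)
  have "bernoulli_sum \<delta> N (\<lambda>S. \<Phi> (insert (Suc N) S)) \<le> bernoulli_sum \<delta> N (\<lambda>S. \<Phi> S + C * (G N S + b N))"
    using assms(1,2) Suc.prems by (intro bernoulli_sum_mono) auto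
  also have "\<dots> = bernoulli_sum \<delta> N \<Phi> + C * (bernoulli_sum \<delta> N (G N) + b N)"
    by (simp only: bernoulli_sum_add bernoulli_sum_cmult bernoulli_sum_const)
  finally have "\<delta> * bernoulli_sum \<delta> N (\<lambda>S. \<Phi> (insert (Suc N) S)) \<le> \<delta> * \<dots>"
    using assms(1) by (rule mult_left_mono)
  then have "bernoulli_sum \<delta> (Suc N) \<Phi> \<le> bernoulli_sum \<delta> N \<Phi> + C * \<delta> * (bernoulli_sum \<delta> N (G N) + b N)"
    by (simp add: algebra_simps)
  also have "bernoulli_sum \<delta> N \<Phi> \<le> \<Phi> {} + C * \<delta> * (\<Sum>j<N. bernoulli_sum \<delta> j (G j) + b j)"
    using Suc.prems by (intro Suc.IH) auto
  finally show ?case by (simp add: algebra_simps)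
qed simp

section \<open>The conditional square function and the Rosenthal-type estimate\<close>

context finite_product
begin

text \<open>Increments are orthogonal to the past; this removes cross terms and first-order terms
  below.\<close>

lemma mean_martingale_increment:
  assumes "meas S g" "S \<subseteq> T"
  shows "mean (\<lambda>x. g x * (cexp T f x - cexp S f x)) = 0"
proof -
  have "mean (\<lambda>x. g x * cexp S (cexp T f) x) = mean (\<lambda>x. g x * cexp T f x)"
    by (rule mean_mult_cexp[OF assms(1)])
  then show ?thesis using assms(2)
    by (simp add: cexp_cexp Int_absorb2 right_diff_distrib mean_diff)
qed

text \<open>The conditional variance of the increment at time \<open>Suc j\<close> given the first
  \<open>j\<close> coordinates. The resulting square function is predictable, so its value one step
  ahead may serve as a weight.\<close>

definition sq_incr :: "((nat \<Rightarrow> 'b) \<Rightarrow> real) \<Rightarrow> nat \<Rightarrow> (nat \<Rightarrow> 'b) \<Rightarrow> real" where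
  "sq_incr f j = cexp {1..j} (\<lambda>x. (cexp {1..Suc j} f x - cexp {1..j} f x)\<^sup>2)"

definition sq_fun :: "((nat \<Rightarrow> 'b) \<Rightarrow> real) \<Rightarrow> nat \<Rightarrow> (nat \<Rightarrow> 'b) \<Rightarrow> real" where
  "sq_fun f N x = (\<Sum>j<N. sq_incr f j x)"

lemma sq_incr_nonneg: "x \<in> \<Omega> \<Longrightarrow> 0 \<le> sq_incr f j x"
  unfolding sq_incr_def by (rule cexp_nonneg) auto

lemma sq_fun_nonneg: "x \<in> \<Omega> \<Longrightarrow> 0 \<le> sq_fun f N x"
  unfolding sq_fun_def by (intro sum_nonneg sq_incr_nonneg)

lemma sq_fun_meas: "N \<le> Suc j \<Longrightarrow> meas {1..j} (sq_fun f N)"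
  unfolding sq_fun_def sq_incr_def by (intro meas_sum meas_mono[OF meas_cexp]) auto

text \<open>
  Summation by parts: with \<open>F\<^sub>j = E\<^bsub>{1..j}\<^esub> f\<close>, under the mean \<open>sq_incr f j\<close> may be replaced by \<open>F\<^bsub>j+1\<^esub>\<^sup>2 - F\<^sub>j\<^sup>2\<close>,
  and the weights increase with \<open>j\<close>.
\<close>

lemma sq_fun_mean_le_aux:
  assumes q: "1 \<le> q"
  shows "mean (\<lambda>x. sq_fun f N x powr q) \<le> q * mean (\<lambda>x. sq_fun f N x powr (q - 1) * (cexp {1..N} f x)\<^sup>2)"
proof (induction N)
  case 0
  then show ?case by (simp add: sq_fun_def)
next
  case (Suc N)
  let ?t = "sq_fun f N" and ?t' = "sq_fun f (Suc N)" and ?F = "cexp {1..N} f" and ?F' = "cexp {1..Suc N} f"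
  let ?g = "\<lambda>x. ?t' x powr (q - 1)"
  have t': "?t' x = ?t x + sq_incr f N x" for x by (simp add: sq_fun_def)
  have g: "meas {1..N} ?g" by (intro meas_comp[OF sq_fun_meas]) simp
  have "mean (\<lambda>x. ?g x * sq_incr f N x) = mean (\<lambda>x. ?g x * (?F' x - ?F x)\<^sup>2)"
    unfolding sq_incr_def by (rule mean_mult_cexp[OF g])
  also have "\<dots> = mean (\<lambda>x. (?g x * (?F' x)\<^sup>2 - ?g x * (?F x)\<^sup>2) - 2 * (?g x * ?F x * (?F' x - ?F x)))"
    by (intro mean_cong) (simp add: power2_eq_square algebra_simps)
  also have "\<dots> = mean (\<lambda>x. ?g x * (?F' x)\<^sup>2) - mean (\<lambda>x. ?g x * (?F x)\<^sup>2)
      - 2 * mean (\<lambda>x. ?g x * ?F x * (?F' x - ?F x))"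
    by (simp only: mean_diff mean_cmult)
  also have "mean (\<lambda>x. ?g x * ?F x * (?F' x - ?F x)) = 0"
    by (intro mean_martingale_increment meas_comp2[OF g meas_cexp]) auto
  finally have incr: "mean (\<lambda>x. ?g x * sq_incr f N x) =
    mean (\<lambda>x. ?g x * (?F' x)\<^sup>2) - mean (\<lambda>x. ?g x * (?F x)\<^sup>2)" by simp
  \<comment> \<open>The tangent is taken at the new value \<open>?t'\<close>: its weight
    \<open>?g\<close> still depends on the first \<open>N\<close> coordinates only, so
    \<open>incr\<close> applies.\<close>
  have "mean (\<lambda>x. ?t' x powr q) \<le> mean (\<lambda>x. ?t x powr q + q * (?g x * sq_incr f N x))"
  proof (intro mean_mono)
    fix x assume x: "x \<in> \<Omega>"
    have "?t' x powr q + q * ?g x * (?t x - ?t' x) \<le> ?t x powr q"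
      by (intro powr_tangent_le q sq_fun_nonneg x)
    then show "?t' x powr q \<le> ?t x powr q + q * (?g x * sq_incr f N x)"
      by (simp add: t' algebra_simps)
  qed
  also have "\<dots> = mean (\<lambda>x. ?t x powr q) + q * mean (\<lambda>x. ?g x * sq_incr f N x)"
    by (simp only: mean_add mean_cmult)
  also have "mean (\<lambda>x. ?t x powr q) \<le> q * mean (\<lambda>x. ?t x powr (q - 1) * (?F x)\<^sup>2)"
    by (rule Suc.IH)
  \<comment> \<open>Raising the old weight to the new one makes this term cancel against the
    negative term of \<open>incr\<close>.\<close>
  also have "mean (\<lambda>x. ?t x powr (q - 1) * (?F x)\<^sup>2) \<le> mean (\<lambda>x. ?g x * (?F x)\<^sup>2)"
    using q by (intro mean_mono mult_right_mono powr_mono2) (auto simp: t' sq_fun_nonneg sq_incr_nonneg)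
  finally show ?case using q by (simp add: incr right_diff_distrib)
qed

text \<open>At time \<open>n\<close> the martingale equals \<open>f\<close>, and
  \<open>young\<close> absorbs half of the left side.\<close>

lemma sq_fun_mean_le:
  assumes q: "1 \<le> q"
    and young: "\<And>u v. 0 \<le> u \<Longrightarrow> 0 \<le> v \<Longrightarrow> q * (u powr (q - 1) * v) \<le> 1/2 * u powr q + C * v powr q"
  shows "mean (\<lambda>x. sq_fun f n x powr q) \<le> 2 * C * mean (\<lambda>x. \<bar>f x\<bar> powr (2 * q))"
proof -
  let ?t = "sq_fun f n"
  have "mean (\<lambda>x. ?t x powr q) \<le> q * mean (\<lambda>x. ?t x powr (q - 1) * (cexp {1..n} f x)\<^sup>2)"
    by (rule sq_fun_mean_le_aux[OF q])
  also have "\<dots> = mean (\<lambda>x. q * (?t x powr (q - 1) * (f x)\<^sup>2))"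
    by (simp only: mean_cmult[symmetric]) (intro mean_cong, simp add: cexp_all)
  also have "\<dots> \<le> mean (\<lambda>x. 1/2 * ?t x powr q + C * \<bar>f x\<bar> powr (2 * q))"
  proof (intro mean_mono)
    fix x assume x: "x \<in> \<Omega>"
    have "(\<bar>f x\<bar> powr 2) powr q = \<bar>f x\<bar> powr (2 * q)" by (rule powr_powr)
    then show "q * (?t x powr (q - 1) * (f x)\<^sup>2) \<le> 1/2 * ?t x powr q + C * \<bar>f x\<bar> powr (2 * q)"
      using young[OF sq_fun_nonneg[OF x, of f n], of "(f x)\<^sup>2"] by simp
  qed
  also have "\<dots> = 1/2 * mean (\<lambda>x. ?t x powr q) + C * mean (\<lambda>x. \<bar>f x\<bar> powr (2 * q))"
    by (simp only: mean_add mean_cmult)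
  finally show ?thesis by simp
qed

text \<open>The second-order bound is averaged; its first-order term is a function of
  \<open>cexp S f\<close> times a martingale increment, so its mean vanishes.\<close>

lemma mean_powr_increment:
  fixes p C :: real and f :: "(nat \<Rightarrow> 'b) \<Rightarrow> real"
  assumes C: "\<And>a d. \<bar>a + d\<bar> powr p \<le> \<bar>a\<bar> powr p + p * (sgn a * \<bar>a\<bar> powr (p - 1)) * d
           + C * (\<bar>a\<bar> powr (p - 2) * d\<^sup>2 + \<bar>d\<bar> powr p)"
    and ST: "S \<subseteq> T"
  shows "mean (\<lambda>x. \<bar>cexp T f x\<bar> powr p) \<le> mean (\<lambda>x. \<bar>cexp S f x\<bar> powr p)
    + C * (mean (\<lambda>x. \<bar>cexp S f x\<bar> powr (p - 2) * (cexp T f x - cexp S f x)\<^sup>2)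
           + mean (\<lambda>x. \<bar>cexp T f x - cexp S f x\<bar> powr p))"
proof -
  let ?a = "cexp S f" and ?d = "\<lambda>x. cexp T f x - cexp S f x"
  let ?s = "\<lambda>x. sgn (?a x) * \<bar>?a x\<bar> powr (p - 1)"
  have "mean (\<lambda>x. \<bar>cexp T f x\<bar> powr p) \<le>
    mean (\<lambda>x. \<bar>?a x\<bar> powr p + p * (?s x * ?d x) + C * (\<bar>?a x\<bar> powr (p - 2) * (?d x)\<^sup>2 + \<bar>?d x\<bar> powr p))"
  proof (intro mean_mono)
    fix x
    show "\<bar>cexp T f x\<bar> powr p \<le> \<bar>?a x\<bar> powr p + p * (?s x * ?d x)
      + C * (\<bar>?a x\<bar> powr (p - 2) * (?d x)\<^sup>2 + \<bar>?d x\<bar> powr p)"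
      using C[of "?a x" "?d x"] by (simp add: mult.assoc)
  qed
  moreover have "mean (\<lambda>x. ?s x * ?d x) = 0"
    by (intro mean_martingale_increment ST meas_comp[OF meas_cexp, of _ "\<lambda>u. sgn u * \<bar>u\<bar> powr (p - 1)"])
  ultimately show ?thesis by (simp add: mean_add mean_cmult)
qed

text \<open>The increment is an average in two ways: of \<open>f - cexp ({1..n} - {Suc j}) f\<close>
  (\<open>d1\<close>, for the p-th power term) and of the increment of the martingale
  \<open>cexp {1..j} f\<close> (\<open>d2\<close>, for the quadratic term). Jensen's inequality is
  applied to each.\<close>

lemma mean_powr_increment_insert:
  assumes p: "2 \<le> p"
    and C: "0 \<le> C" "\<And>a d. \<bar>a + d\<bar> powr p \<le> \<bar>a\<bar> powr p + p * (sgn a * \<bar>a\<bar> powr (p - 1)) * d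
           + C * (\<bar>a\<bar> powr (p - 2) * d\<^sup>2 + \<bar>d\<bar> powr p)"
    and S: "S \<subseteq> {1..j}" and j: "j < n"
  shows "mean (\<lambda>x. \<bar>cexp (insert (Suc j) S) f x\<bar> powr p) \<le> mean (\<lambda>x. \<bar>cexp S f x\<bar> powr p)
    + C * (mean (\<lambda>x. \<bar>cexp S f x\<bar> powr (p - 2) * cexp S (sq_incr f j) x)
           + mean (\<lambda>x. \<bar>f x - cexp ({1..n} - {Suc j}) f x\<bar> powr p))"
proof -
  let ?T = "insert (Suc j) S" and ?w = "\<lambda>x. \<bar>cexp S f x\<bar> powr (p - 2)"
  let ?D = "\<lambda>x. cexp {1..Suc j} f x - cexp {1..j} f x"
  have w: "meas S ?w" by (rule meas_comp[OF meas_cexp])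
  have sets: "?T \<inter> ({1..n} - {Suc j}) = S" "?T \<inter> {1..Suc j} = ?T" "?T \<inter> {1..j} = S" "S \<inter> {1..j} = S"
    using S j by auto
  have d1: "cexp ?T f x - cexp S f x = cexp ?T (\<lambda>x. f x - cexp ({1..n} - {Suc j}) f x) x" for x
    by (simp only: cexp_diff cexp_cexp sets)
  have d2: "cexp ?T f x - cexp S f x = cexp ?T ?D x" for x
    by (simp only: cexp_diff cexp_cexp sets)
  have "mean (\<lambda>x. ?w x * (cexp ?T f x - cexp S f x)\<^sup>2) \<le> mean (\<lambda>x. ?w x * cexp ?T (\<lambda>x. (?D x)\<^sup>2) x)"
  proof (intro mean_mono mult_left_mono)
    fix x assume "x \<in> \<Omega>"
    then show "(cexp ?T f x - cexp S f x)\<^sup>2 \<le> cexp ?T (\<lambda>x. (?D x)\<^sup>2) x"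
      using norm_cexp_powr_le[of 2 x ?T ?D] by (simp add: d2)
  qed simp
  also have "\<dots> = mean (\<lambda>x. ?w x * (?D x)\<^sup>2)"
    by (rule mean_mult_cexp, rule meas_mono[OF w]) auto
  also have "\<dots> = mean (\<lambda>x. ?w x * cexp S (\<lambda>x. (?D x)\<^sup>2) x)"
    by (rule mean_mult_cexp[OF w, symmetric])
  also have "\<dots> = mean (\<lambda>x. ?w x * cexp S (sq_incr f j) x)"
    by (simp only: sq_incr_def cexp_cexp sets)
  finally have a: "mean (\<lambda>x. ?w x * (cexp ?T f x - cexp S f x)\<^sup>2) \<le> mean (\<lambda>x. ?w x * cexp S (sq_incr f j) x)" .
  have b: "mean (\<lambda>x. \<bar>cexp ?T f x - cexp S f x\<bar> powr p) \<le> mean (\<lambda>x. \<bar>f x - cexp ({1..n} - {Suc j}) f x\<bar> powr p)"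
    using mean_norm_cexp_powr_le[of p ?T "\<lambda>x. f x - cexp ({1..n} - {Suc j}) f x"] p by (simp add: d1)
  have "S \<subseteq> ?T" by auto
  from mean_powr_increment[OF C(2) this, of f] show ?thesis
    using mult_left_mono[OF add_mono[OF a b] C(1)] by linarith
qed

text \<open>For fixed \<open>S\<close> the weights are bounded by the maximal function, and what
  remains sums to \<open>cexp S (sq_fun f n)\<close>. Young's inequality separates the two factors;
  Doob's inequality and the square function bound then handle one each.\<close>

lemma weighted_square_sum_le:
  assumes p: "2 \<le> p" and \<delta>: "0 \<le> \<delta>" and S: "S \<subseteq> {1..n}" and nonneg: "0 \<le> \<epsilon>" "0 \<le> Cy"
    and doob: "\<And>u v. 0 \<le> u \<Longrightarrow> 0 \<le> v \<Longrightarrow> u powr (p - 1) * v \<le> 1/4 * u powr p + Cd * v powr p"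
    and square: "\<And>u v. 0 \<le> u \<Longrightarrow> 0 \<le> v \<Longrightarrow> p / 2 * (u powr (p / 2 - 1) * v) \<le> 1/2 * u powr (p / 2) + Cs * v powr (p / 2)"
    and young: "\<And>u w. 0 \<le> u \<Longrightarrow> 0 \<le> w \<Longrightarrow> u powr (p - 2) * w \<le> \<epsilon> * u powr p + Cy * w powr (p / 2)"
  shows "\<delta> * (\<Sum>j<n. mean (\<lambda>x. \<bar>cexp (S \<inter> {1..j}) f x\<bar> powr (p - 2) * cexp (S \<inter> {1..j}) (sq_incr f j) x))
    \<le> 4 * \<epsilon> * Cd * mean (\<lambda>x. \<bar>cexp S f x\<bar> powr p) + 2 * Cy * Cs * (\<delta> powr (p / 2) * mean (\<lambda>x. \<bar>f x\<bar> powr p))"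
proof -
  let ?X = "\<lambda>j x. \<bar>cexp (S \<inter> {1..j}) f x\<bar>"
  let ?M = "run_max ?X n"
  let ?w = "cexp S (sq_fun f n)"
  have S_n: "S \<inter> {1..n} = S" using S by auto
  have M: "0 \<le> ?M x" for x by (intro run_max_nonneg) simp
  have w: "0 \<le> ?w x" if "x \<in> \<Omega>" for x by (intro cexp_nonneg sq_fun_nonneg that)
  \<comment> \<open>\<open>sq_incr f j\<close> is itself an average given \<open>{1..j}\<close>, so
    conditioning on all of \<open>S\<close> changes nothing and the terms can be added.\<close>
  have incr: "cexp (S \<inter> {1..j}) (sq_incr f j) = cexp S (sq_incr f j)" for j
    by (simp add: sq_incr_def cexp_cexp' Int_assoc)
  have w_sum: "?w x = (\<Sum>j<n. cexp S (sq_incr f j) x)" for x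
    by (simp add: sq_fun_def[abs_def] cexp_sum)
  have "\<delta> * (\<Sum>j<n. mean (\<lambda>x. ?X j x powr (p - 2) * cexp (S \<inter> {1..j}) (sq_incr f j) x))
      = mean (\<lambda>x. \<delta> * (\<Sum>j<n. ?X j x powr (p - 2) * cexp S (sq_incr f j) x))"
    by (simp only: incr mean_cmult mean_sum)
  also have "\<dots> \<le> mean (\<lambda>x. \<epsilon> * ?M x powr p + Cy * \<delta> powr (p / 2) * ?w x powr (p / 2))"
  proof (intro mean_mono)
    fix x assume x: "x \<in> \<Omega>"
    have "(\<Sum>j<n. ?X j x powr (p - 2) * cexp S (sq_incr f j) x) \<le> (\<Sum>j<n. ?M x powr (p - 2) * cexp S (sq_incr f j) x)"
      using p x by (intro sum_mono mult_right_mono powr_mono2 cexp_nonneg sq_incr_nonneg run_max_ge) auto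
    also have "\<dots> = ?M x powr (p - 2) * ?w x" by (simp only: w_sum sum_distrib_left)
    \<comment> \<open>Keeping \<delta> next to the square function is what produces
      \<open>\<delta> powr (p / 2)\<close> after Young's inequality.\<close>
    finally have "\<delta> * (\<Sum>j<n. ?X j x powr (p - 2) * cexp S (sq_incr f j) x) \<le> ?M x powr (p - 2) * (\<delta> * ?w x)"
      using \<delta> by (simp add: mult.left_commute mult_left_mono)
    also have "\<dots> \<le> \<epsilon> * ?M x powr p + Cy * (\<delta> * ?w x) powr (p / 2)"
      using M w x \<delta> by (intro young) auto
    finally show "\<delta> * (\<Sum>j<n. ?X j x powr (p - 2) * cexp S (sq_incr f j) x)
        \<le> \<epsilon> * ?M x powr p + Cy * \<delta> powr (p / 2) * ?w x powr (p / 2)"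
      by (simp add: powr_mult mult.assoc)
  qed
  also have "\<dots> = \<epsilon> * mean (\<lambda>x. ?M x powr p) + Cy * \<delta> powr (p / 2) * mean (\<lambda>x. ?w x powr (p / 2))"
    by (simp only: mean_add mean_cmult)
  finally have main: "\<delta> * (\<Sum>j<n. mean (\<lambda>x. ?X j x powr (p - 2) * cexp (S \<inter> {1..j}) (sq_incr f j) x)) \<le> \<dots>" .
  have M_le: "mean (\<lambda>x. ?M x powr p) \<le> 4 * Cd * mean (\<lambda>x. \<bar>cexp S f x\<bar> powr p)"
  proof -
    have "mono (\<lambda>j. S \<inter> {1..j})" by (auto simp: mono_def)
    from Doob_maximal[OF p doob this, of f n] show ?thesis by (simp only: S_n)
  qed
  have "mean (\<lambda>x. ?w x powr (p / 2)) \<le> mean (cexp S (\<lambda>x. sq_fun f n x powr (p / 2)))"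
    using p by (intro mean_mono cexp_powr_Jensen sq_fun_nonneg) auto
  also have "\<dots> = mean (\<lambda>x. sq_fun f n x powr (p / 2))" by (rule mean_cexp)
  also have "\<dots> \<le> 2 * Cs * mean (\<lambda>x. \<bar>f x\<bar> powr p)"
    using sq_fun_mean_le[of "p / 2" Cs f, OF _ square] p by simp
  finally have w_le: "mean (\<lambda>x. ?w x powr (p / 2)) \<le> 2 * Cs * mean (\<lambda>x. \<bar>f x\<bar> powr p)" .
  have "0 \<le> Cy * \<delta> powr (p / 2)" using nonneg by simp
  from add_mono[OF mult_left_mono[OF M_le nonneg(1)] mult_left_mono[OF w_le this]] main
  show ?thesis by (simp add: mult_ac)
qed

text \<open>Telescoping over the revealed indices, then \<open>weighted_square_sum_le\<close> for
  each full set \<open>S\<close>. By \<open>absorb\<close>, the part of the bound that repeats the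
  left side has coefficient 1/2.\<close>

lemma bernoulli_mean_powr_le:
  assumes p: "2 \<le> p" and \<delta>: "0 \<le> \<delta>" "\<delta> \<le> 1" and f: "mean f = 0" and nonneg: "0 \<le> \<epsilon>" "0 \<le> Cy"
    and Ct: "0 \<le> Ct" "\<And>a d. \<bar>a + d\<bar> powr p \<le> \<bar>a\<bar> powr p + p * (sgn a * \<bar>a\<bar> powr (p - 1)) * d
           + Ct * (\<bar>a\<bar> powr (p - 2) * d\<^sup>2 + \<bar>d\<bar> powr p)"
    and doob: "\<And>u v. 0 \<le> u \<Longrightarrow> 0 \<le> v \<Longrightarrow> u powr (p - 1) * v \<le> 1/4 * u powr p + Cd * v powr p"
    and square: "\<And>u v. 0 \<le> u \<Longrightarrow> 0 \<le> v \<Longrightarrow> p / 2 * (u powr (p / 2 - 1) * v) \<le> 1/2 * u powr (p / 2) + Cs * v powr (p / 2)"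
    and young: "\<And>u w. 0 \<le> u \<Longrightarrow> 0 \<le> w \<Longrightarrow> u powr (p - 2) * w \<le> \<epsilon> * u powr p + Cy * w powr (p / 2)"
    and absorb: "Ct * (4 * \<epsilon> * Cd) = 1/2"
  shows "bernoulli_sum \<delta> n (\<lambda>S. mean (\<lambda>x. \<bar>cexp S f x\<bar> powr p))
    \<le> 2 * Ct * (\<delta> * (\<Sum>j=1..n. mean (\<lambda>x. \<bar>f x - cexp ({1..n} - {j}) f x\<bar> powr p)))
      + 4 * Ct * Cy * Cs * (\<delta> powr (p / 2) * mean (\<lambda>x. \<bar>f x\<bar> powr p))"
proof -
  let ?\<Phi> = "\<lambda>S. mean (\<lambda>x. \<bar>cexp S f x\<bar> powr p)"
  let ?G = "\<lambda>j S. mean (\<lambda>x. \<bar>cexp S f x\<bar> powr (p - 2) * cexp S (sq_incr f j) x)"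
  let ?b = "\<lambda>j. mean (\<lambda>x. \<bar>f x - cexp ({1..n} - {Suc j}) f x\<bar> powr p)"
  let ?B = "bernoulli_sum \<delta> n"
  let ?R = "\<delta> powr (p / 2) * mean (\<lambda>x. \<bar>f x\<bar> powr p)"
  have "?B ?\<Phi> \<le> ?\<Phi> {} + Ct * \<delta> * (\<Sum>j<n. bernoulli_sum \<delta> j (?G j) + ?b j)"
    by (rule bernoulli_sum_telescope[OF \<delta>, where G = ?G and b = ?b])
       (rule mean_powr_increment_insert[OF p Ct])
  \<comment> \<open>The martingale starts at \<open>mean f\<close>; here mean zero enters.\<close>
  also have "?\<Phi> {} = 0" by (simp add: cexp_empty f)
  \<comment> \<open>All summands are rewritten over one common random set, since the maximal
    function needs a whole trajectory.\<close>
  also have "(\<Sum>j<n. bernoulli_sum \<delta> j (?G j) + ?b j) = (\<Sum>j<n. ?B (\<lambda>S. ?G j (S \<inter> {1..j})) + ?b j)"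
  proof (intro sum.cong refl arg_cong2[of _ _ _ _ "(+)"])
    fix j assume "j \<in> {..<n}"
    then show "bernoulli_sum \<delta> j (?G j) = ?B (\<lambda>S. ?G j (S \<inter> {1..j}))"
      using bernoulli_sum_Int[of j n \<delta> "?G j"] by (simp only: lessThan_iff less_imp_le)
  qed
  also have "\<dots> = ?B (\<lambda>S. \<Sum>j<n. ?G j (S \<inter> {1..j})) + (\<Sum>j<n. ?b j)"
    by (simp only: sum.distrib bernoulli_sum_sum)
  also have "0 + Ct * \<delta> * \<dots> = Ct * ?B (\<lambda>S. \<delta> * (\<Sum>j<n. ?G j (S \<inter> {1..j}))) + Ct * (\<delta> * (\<Sum>j<n. ?b j))"
    by (simp only: bernoulli_sum_cmult) (simp add: algebra_simps)
  also have "?B (\<lambda>S. \<delta> * (\<Sum>j<n. ?G j (S \<inter> {1..j}))) \<le> ?B (\<lambda>S. 4 * \<epsilon> * Cd * ?\<Phi> S + 2 * Cy * Cs * ?R)"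
    using weighted_square_sum_le[OF p \<delta>(1) _ nonneg doob square young]
    by (intro bernoulli_sum_mono \<delta>) auto
  also have "\<dots> = 4 * \<epsilon> * Cd * ?B ?\<Phi> + 2 * Cy * Cs * ?R"
    by (simp only: bernoulli_sum_add bernoulli_sum_cmult bernoulli_sum_const)
  also have "(\<Sum>j<n. ?b j) = (\<Sum>j=1..n. mean (\<lambda>x. \<bar>f x - cexp ({1..n} - {j}) f x\<bar> powr p))"
    by (rule sum.reindex_bij_witness[of _ "\<lambda>j. j - 1" Suc]) auto
  finally have "?B ?\<Phi> \<le> Ct * (4 * \<epsilon> * Cd * ?B ?\<Phi> + 2 * Cy * Cs * ?R)
      + Ct * (\<delta> * (\<Sum>j=1..n. mean (\<lambda>x. \<bar>f x - cexp ({1..n} - {j}) f x\<bar> powr p)))"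
    by (simp add: Ct(1) mult_left_mono)
  also have "Ct * (4 * \<epsilon> * Cd * ?B ?\<Phi> + 2 * Cy * Cs * ?R) = Ct * (4 * \<epsilon> * Cd) * ?B ?\<Phi> + 2 * Ct * Cy * Cs * ?R"
    by (simp add: algebra_simps)
  finally show ?thesis unfolding absorb by simp
qed

end

section \<open>From Bernoulli sets to uniform \<open>k\<close>-subsets\<close>

lemma bernoulli_sum_eq_sum_Pow:
  "bernoulli_sum \<delta> n g = (\<Sum>S\<in>Pow {1..n}. \<delta> ^ card S * (1 - \<delta>) ^ (n - card S) * g S)"
proof (induction n arbitrary: g)
  case (Suc n)
  let ?P = "Pow {1..n}" and ?i = "insert (Suc n)"
  let ?h = "\<lambda>S. \<delta> ^ card S * (1 - \<delta>) ^ (Suc n - card S) * g S"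
  have card_le: "card S \<le> n" if "S \<in> ?P" for S
    using that card_mono[of "{1..n}" S] by simp
  have card_i: "card (?i S) = Suc (card S)" if "S \<in> ?P" for S
    using that finite_subset[of S "{1..n}"] by (subst card_insert_disjoint) auto
  have Pow: "Pow {1..Suc n} = ?P \<union> ?i ` ?P"
    using atLeastAtMostSuc_conv[of 1 n] by (simp only: Pow_insert)
  have "(\<Sum>S\<in>Pow {1..Suc n}. ?h S) = (\<Sum>S\<in>?P. ?h S) + (\<Sum>S\<in>?i ` ?P. ?h S)"
    unfolding Pow by (rule sum.union_disjoint) auto
  also have "(\<Sum>S\<in>?i ` ?P. ?h S) = (\<Sum>S\<in>?P. ?h (?i S))"
  proof (rule sum.reindex_cong[OF _ refl refl])
    show "inj_on ?i ?P" by (rule inj_onI) (auto dest!: insert_ident[THEN iffD1, rotated 2])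
  qed
  also have "\<dots> = \<delta> * bernoulli_sum \<delta> n (\<lambda>S. g (?i S))"
    unfolding Suc.IH sum_distrib_left by (intro sum.cong refl) (simp add: card_i)
  also have "(\<Sum>S\<in>?P. ?h S) = (1 - \<delta>) * bernoulli_sum \<delta> n g"
    unfolding Suc.IH sum_distrib_left by (intro sum.cong refl) (simp add: Suc_diff_le card_le)
  finally show ?case by simp
qed simp

definition subset_average :: "nat \<Rightarrow> nat \<Rightarrow> (nat set \<Rightarrow> real) \<Rightarrow> real" where
  "subset_average n k g = 1 / real (n choose k) * (\<Sum>S | S \<subseteq> {1..n} \<and> card S = k. g S)"

lemma finite_subsets_card: "finite {S. S \<subseteq> {1..n} \<and> card S = k}" for n k :: nat
  by (rule finite_subset[of _ "Pow {1..n}"]) auto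

lemma subset_average_mono:
  "(\<And>S. S \<subseteq> {1..n} \<Longrightarrow> g S \<le> h S) \<Longrightarrow> subset_average n k g \<le> subset_average n k h"
  unfolding subset_average_def by (intro mult_left_mono sum_mono) auto

lemma subset_average_add:
  "subset_average n k (\<lambda>S. g S + h S) = subset_average n k g + subset_average n k h"
  by (simp add: subset_average_def sum.distrib distrib_left)

lemma subset_average_cmult: "subset_average n k (\<lambda>S. c * g S) = c * subset_average n k g"
  by (simp add: subset_average_def sum_distrib_left[symmetric])

lemma subset_average_const: "k \<le> n \<Longrightarrow> subset_average n k (\<lambda>S. c) = c"
  using n_subsets[of "{1..n}" k] by (simp add: subset_average_def)

text \<open>A Bernoulli set has binomial size and, given its size, is uniform; the size
  probabilities are the Bernstein polynomials at \<delta>.\<close>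

lemma bernoulli_sum_eq_Bernstein:
  "bernoulli_sum \<delta> n g = (\<Sum>l\<le>n. Bernstein n l \<delta> * subset_average n l g)"
proof -
  have "bernoulli_sum \<delta> n g =
      (\<Sum>l\<le>n. \<Sum>S\<in>{S \<in> Pow {1..n}. card S = l}. \<delta> ^ card S * (1 - \<delta>) ^ (n - card S) * g S)"
    unfolding bernoulli_sum_eq_sum_Pow
    using card_mono[of "{1..n}"] by (intro sum.group[symmetric]) auto
  also have "\<dots> = (\<Sum>l\<le>n. Bernstein n l \<delta> * subset_average n l g)"
  proof (intro sum.cong refl)
    fix l assume "l \<in> {..n}"
    then have "real (n choose l) \<noteq> 0" by simp
    then show "(\<Sum>S\<in>{S \<in> Pow {1..n}. card S = l}. \<delta> ^ card S * (1 - \<delta>) ^ (n - card S) * g S)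
        = Bernstein n l \<delta> * subset_average n l g"
      by (simp add: Bernstein_def subset_average_def sum_distrib_left mult.assoc)
  qed
  finally show ?thesis .
qed

text \<open>Double counting: pairs of an \<open>l\<close>-set and a point outside it correspond to
  pairs of an \<open>(l+1)\<close>-set and a point inside it.\<close>

lemma subset_average_Suc:
  assumes l: "l < n" and mono: "\<And>S i. S \<subseteq> {1..n} \<Longrightarrow> i \<in> {1..n} \<Longrightarrow> g S \<le> g (insert i S)"
  shows "subset_average n l g \<le> subset_average n (Suc l) g"
proof -
  let ?L = "\<lambda>k. {S. S \<subseteq> {1..n} \<and> card S = k}"
  have fin: "finite S" if "S \<subseteq> {1..n}" for S using that finite_subset by blast
  have "real (n - l) * sum g (?L l) = (\<Sum>S\<in>?L l. \<Sum>i\<in>{1..n} - S. g S)"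
    by (simp add: card_Diff_subset fin sum_distrib_left)
  also have "\<dots> \<le> (\<Sum>S\<in>?L l. \<Sum>i\<in>{1..n} - S. g (insert i S))"
    by (intro sum_mono mono) auto
  also have "\<dots> = (\<Sum>(S, i)\<in>Sigma (?L l) (\<lambda>S. {1..n} - S). g (insert i S))"
    by (rule sum.Sigma) (auto simp: finite_subsets_card)
  also have "\<dots> = (\<Sum>(T, i)\<in>Sigma (?L (Suc l)) (\<lambda>T. T). g T)"
  proof (rule sum.reindex_bij_witness[of _ "\<lambda>(T, i). (T - {i}, i)" "\<lambda>(S, i). (insert i S, i)"])
    fix a assume "a \<in> Sigma (?L (Suc l)) (\<lambda>T. T)"
    then obtain T i where a: "a = (T, i)" "T \<subseteq> {1..n}" "card T = Suc l" "i \<in> T" by auto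
    then have "card (T - {i}) = l" using fin[of T] by (simp add: card_Diff_singleton)
    then show "(case a of (T, i) \<Rightarrow> (T - {i}, i)) \<in> Sigma (?L l) (\<lambda>S. {1..n} - S)"
      using a by auto
    show "(case case a of (T, i) \<Rightarrow> (T - {i}, i) of (S, i) \<Rightarrow> (insert i S, i)) = a"
      using a by (simp add: insert_absorb)
  next
    fix a assume "a \<in> Sigma (?L l) (\<lambda>S. {1..n} - S)"
    then obtain S i where a: "a = (S, i)" "S \<subseteq> {1..n}" "card S = l" "i \<in> {1..n}" "i \<notin> S" by auto
    then have "card (insert i S) = Suc l" using fin[of S] by simp
    then show "(case a of (S, i) \<Rightarrow> (insert i S, i)) \<in> Sigma (?L (Suc l)) (\<lambda>T. T)"
      using a by auto
    show "(case case a of (S, i) \<Rightarrow> (insert i S, i) of (T, i) \<Rightarrow> (T - {i}, i)) = a"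
      using a by auto
    show "(case case a of (S, i) \<Rightarrow> (insert i S, i) of (T, i) \<Rightarrow> g T) = (case a of (S, i) \<Rightarrow> g (insert i S))"
      using a by simp
  qed
  also have "\<dots> = (\<Sum>T\<in>?L (Suc l). \<Sum>i\<in>T. g T)"
    by (rule sum.Sigma[symmetric]) (auto simp: finite_subsets_card fin)
  also have "\<dots> = real (Suc l) * sum g (?L (Suc l))"
    by (simp add: sum_distrib_left)
  finally have le: "real (n - l) * sum g (?L l) \<le> real (Suc l) * sum g (?L (Suc l))" .
  have "(n choose Suc l) * Suc l = (n choose l) * (n - l)"
    using binomial_absorb_comp[of n l] Suc_times_binomial_add[of l "n - Suc l"] l
    by (metis binomial_absorption mult.commute)
  then have ch: "real (n choose Suc l) * real (Suc l) = real (n choose l) * real (n - l)"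
    by (metis of_nat_mult)
  have pos: "0 < real (n choose l)" "0 < real (n choose Suc l)" "0 < real (n - l)"
    using l by (auto simp: Suc_leI)
  have "sum g (?L l) * real (n choose Suc l) * real (n - l) \<le> real (Suc l) * sum g (?L (Suc l)) * real (n choose Suc l)"
    using mult_right_mono[OF le, of "real (n choose Suc l)"] pos by (simp add: mult_ac)
  also have "\<dots> = sum g (?L (Suc l)) * real (n choose l) * real (n - l)"
    using ch by (simp add: mult_ac)
  finally have "sum g (?L l) * real (n choose Suc l) \<le> sum g (?L (Suc l)) * real (n choose l)"
    using pos by simp
  then show ?thesis unfolding subset_average_def using pos by (simp add: field_simps)
qed

lemma subset_average_mono_card:
  assumes "k \<le> l" "l \<le> n" and mono: "\<And>S i. S \<subseteq> {1..n} \<Longrightarrow> i \<in> {1..n} \<Longrightarrow> g S \<le> g (insert i S)"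
  shows "subset_average n k g \<le> subset_average n l g"
  using assms(1,2)
proof (induction l rule: dec_induct)
  case (step l)
  then show ?case using subset_average_Suc[of l n g, OF _ mono] by fastforce
qed simp

text \<open>Chebyshev's inequality for a binomial variable of mean \<open>2k\<close> and variance at
  most \<open>2k\<close>. Being below \<open>k\<close> means a deviation of at least
  \<open>k + 1\<close>, and \<open>4k\<close> is at most \<open>(k+1)^2\<close>; a deviation of
  \<open>k\<close> alone would not suffice for small \<open>k\<close>.\<close>

lemma Bernstein_lower_tail:
  assumes k: "1 \<le> k" "2 * k \<le> n"
  shows "(\<Sum>l<k. Bernstein n l (2 * real k / real n)) \<le> 1/2"
proof -
  define d where "d = 2 * real k / real n"
  let ?b = "\<lambda>l. Bernstein n l d"
  have nd: "real n * d = 2 * real k" and d: "0 \<le> d" "d \<le> 1" using k by (auto simp: d_def)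
  have b: "0 \<le> ?b l" for l using d by (intro Bernstein_nonneg) auto
  have "(real k + 1)\<^sup>2 * (\<Sum>l<k. ?b l) = (\<Sum>l<k. (real k + 1)\<^sup>2 * ?b l)"
    by (rule sum_distrib_left)
  also have "\<dots> \<le> (\<Sum>l<k. (real l - 2 * real k)\<^sup>2 * ?b l)"
  proof (intro sum_mono mult_right_mono b)
    fix l assume "l \<in> {..<k}"
    then have "real l + 1 \<le> real k" by simp
    then have "real k + 1 \<le> 2 * real k - real l" by simp
    then have "(real k + 1)\<^sup>2 \<le> (2 * real k - real l)\<^sup>2" by (intro power_mono) auto
    then show "(real k + 1)\<^sup>2 \<le> (real l - 2 * real k)\<^sup>2" by (simp only: power2_commute)
  qed
  also have "\<dots> \<le> (\<Sum>l\<le>n. (real l - 2 * real k)\<^sup>2 * ?b l)"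
    using k b by (intro sum_mono2) auto
  \<comment> \<open>The square is expanded in factorial moments, whose sums against Bernstein
    polynomials are explicit.\<close>
  also have "\<dots> = (\<Sum>l\<le>n. real l * (real l - 1) * ?b l + (1 - 4 * real k) * (real l * ?b l) + (2 * real k)\<^sup>2 * ?b l)"
    by (intro sum.cong refl) (simp add: power2_eq_square algebra_simps)
  also have "\<dots> = real n * (real n - 1) * d\<^sup>2 + (1 - 4 * real k) * (real n * d) + (2 * real k)\<^sup>2"
    by (simp only: sum.distrib sum_distrib_left[symmetric] sum_k_Bernstein sum_kk_Bernstein sum_Bernstein mult_1_right)
  also have "\<dots> = (real n * d)\<^sup>2 - (real n * d) * d + (1 - 4 * real k) * (real n * d) + (2 * real k)\<^sup>2"
    by (simp only: power2_eq_square) (simp add: algebra_simps)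
  also have "\<dots> = 2 * real k - 2 * real k * d"
    unfolding nd by (simp add: power2_eq_square algebra_simps)
  also have "\<dots> \<le> 2 * real k" using d by simp
  also have "\<dots> \<le> (real k + 1)\<^sup>2 * (1/2)"
    using zero_le_power2[of "real k - 1"] by (simp add: power2_eq_square algebra_simps)
  finally show ?thesis unfolding d_def by (rule mult_left_le_imp_le) simp
qed

text \<open>Sizes at least \<open>k\<close> carry half of the probability, and by monotonicity their
  averages dominate the one at size \<open>k\<close>.\<close>

lemma subset_average_le_bernoulli_sum:
  assumes k: "1 \<le> k" "2 * k \<le> n"
    and nonneg: "\<And>S. S \<subseteq> {1..n} \<Longrightarrow> 0 \<le> g S"
    and mono: "\<And>S i. S \<subseteq> {1..n} \<Longrightarrow> i \<in> {1..n} \<Longrightarrow> g S \<le> g (insert i S)"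
  shows "subset_average n k g \<le> 2 * bernoulli_sum (2 * real k / real n) n g"
proof -
  let ?d = "2 * real k / real n"
  let ?b = "\<lambda>l. Bernstein n l ?d" and ?a = "\<lambda>l. subset_average n l g"
  have b: "0 \<le> ?b l" for l using k by (intro Bernstein_nonneg) auto
  have a: "0 \<le> ?a l" for l
    unfolding subset_average_def using nonneg by (intro mult_nonneg_nonneg sum_nonneg) auto
  have split: "(\<Sum>l\<le>n. h l) = (\<Sum>l<k. h l) + (\<Sum>l=k..n. h l)" for h :: "nat \<Rightarrow> real"
  proof -
    have "{..n} = {..<k} \<union> {k..n}" using k by auto
    then show ?thesis by (simp add: sum.union_disjoint ivl_disj_int)
  qed
  have "1/2 \<le> (\<Sum>l=k..n. ?b l)"
    using split[of ?b] Bernstein_lower_tail[OF k] by simp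
  then have "1/2 * ?a k \<le> (\<Sum>l=k..n. ?b l) * ?a k" using a by (rule mult_right_mono)
  also have "\<dots> \<le> (\<Sum>l=k..n. ?b l * ?a l)"
    unfolding sum_distrib_right using mono b by (intro sum_mono mult_left_mono subset_average_mono_card) auto
  also have "\<dots> \<le> (\<Sum>l\<le>n. ?b l * ?a l)"
    unfolding split using a b by (simp add: sum_nonneg)
  finally show ?thesis by (simp add: bernoulli_sum_eq_Bernstein)
qed

section \<open>Uniform subsets, constants independent of the space, and complex values\<close>

context finite_product
begin

lemma mean_powr_cexp_mono:
  assumes "1 \<le> r" "S \<subseteq> T"
  shows "mean (\<lambda>x. norm (cexp S f x) powr r) \<le> mean (\<lambda>x. norm (cexp T f x) powr r)"
  using mean_norm_cexp_powr_le[OF assms(1), of S "cexp T f"] assms(2) by (simp add: cexp_cexp Int_absorb2)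

lemma Re_mean: "Re (mean f) = mean (\<lambda>x. Re (f x))"
  by (simp add: mean_def)

lemma Im_mean: "Im (mean f) = mean (\<lambda>x. Im (f x))"
  by (simp add: mean_def)

lemma Re_cexp: "Re (cexp S f x) = cexp S (\<lambda>x. Re (f x)) x"
  by (simp add: cexp_def Re_mean)

lemma Im_cexp: "Im (cexp S f x) = cexp S (\<lambda>x. Im (f x)) x"
  by (simp add: cexp_def Im_mean)

lemma subset_average_mean_powr_le:
  assumes p: "2 \<le> p" and K: "0 < K" and k: "k \<in> {1..n}"
    and bern: "\<And>\<delta>. 0 \<le> \<delta> \<Longrightarrow> \<delta> \<le> 1 \<Longrightarrow>
      bernoulli_sum \<delta> n (\<lambda>S. mean (\<lambda>x. \<bar>cexp S f x\<bar> powr p)) \<le> K * (\<delta> * b + \<delta> powr (p / 2) * mean (\<lambda>x. \<bar>f x\<bar> powr p))"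
    and b: "0 \<le> b"
  shows "subset_average n k (\<lambda>S. mean (\<lambda>x. \<bar>cexp S f x\<bar> powr p))
    \<le> (2 * K + 1) * 2 powr (p / 2) * (real k / real n * b + (real k / real n) powr (p / 2) * mean (\<lambda>x. \<bar>f x\<bar> powr p))"
proof -
  let ?\<Phi> = "\<lambda>S. mean (\<lambda>x. \<bar>cexp S f x\<bar> powr p)"
  let ?a = "mean (\<lambda>x. \<bar>f x\<bar> powr p)" and ?q = "real k / real n"
  let ?c = "2 powr (p / 2) :: real"
  let ?R = "?q * b + ?q powr (p / 2) * ?a"
  have a: "0 \<le> ?a" by (intro mean_nonneg) simp
  then have R: "0 \<le> ?R" using b by simp
  have cR: "0 \<le> ?c * ?R" using R by simp
  then have KcR: "0 \<le> K * (?c * ?R)" using K by simp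
  have expand: "(2 * K + 1) * ?c * ?R = 2 * (K * (?c * ?R)) + ?c * ?R"
    by (simp only: distrib_right mult.assoc mult_1_left)
  \<comment> \<open>This lets the single factor \<open>2 powr (p / 2)\<close> pay for replacing
    \<open>k/n\<close> by \<open>2k/n\<close> in both terms.\<close>
  have c: "2 \<le> ?c" using powr_mono[of 1 "p / 2" "2::real"] p by simp
  have two: "(2 * ?q) powr (p / 2) = ?c * ?q powr (p / 2)" by (rule powr_mult)
  show ?thesis
  proof (cases "2 * k \<le> n")
    case True
    have "subset_average n k ?\<Phi> \<le> 2 * bernoulli_sum (2 * real k / real n) n ?\<Phi>"
    proof (rule subset_average_le_bernoulli_sum)
      show "?\<Phi> S \<le> ?\<Phi> (insert i S)" for S i
        using mean_powr_cexp_mono[of p S "insert i S" f] p by auto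
    qed (use k True in \<open>auto intro: mean_nonneg\<close>)
    also have "2 * real k / real n = 2 * ?q" by simp
    also have "bernoulli_sum (2 * ?q) n ?\<Phi> \<le> K * (2 * ?q * b + (2 * ?q) powr (p / 2) * ?a)"
      using True k by (intro bern) auto
    also have "2 * ?q * b + (2 * ?q) powr (p / 2) * ?a = 2 * (?q * b) + ?c * (?q powr (p / 2) * ?a)"
      by (simp only: two mult.assoc)
    also have "\<dots> \<le> ?c * (?q * b) + ?c * (?q powr (p / 2) * ?a)"
      using c b a by (intro add_mono mult_right_mono) auto
    also have "\<dots> = ?c * ?R" by (simp only: distrib_left)
    finally have "subset_average n k ?\<Phi> \<le> 2 * (K * (?c * ?R))"
      using K by simp
    also have "\<dots> \<le> (2 * K + 1) * ?c * ?R" using cR unfolding expand by linarith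
    finally show ?thesis .
  next
    \<comment> \<open>Here \<open>2k/n\<close> exceeds 1 and is no probability, but then the second
      term alone dominates, because averaging is a contraction.\<close>
    case False
    have "subset_average n k ?\<Phi> \<le> subset_average n k (\<lambda>S. ?a)"
      using mean_norm_cexp_powr_le[of p _ f] p by (intro subset_average_mono) auto
    also have "\<dots> = 1 * ?a" using k by (simp add: subset_average_const)
    also have "1 \<le> (2 * ?q) powr (p / 2)"
      using False k p by (intro ge_one_powr_ge_zero) auto
    also have "\<dots> * ?a \<le> ?c * ?R" unfolding two distrib_left using b by simp
    also have "\<dots> \<le> (2 * K + 1) * ?c * ?R" using KcR unfolding expand by linarith
    finally show ?thesis using a by (simp add: mult_right_mono)
  qed
qed

end

text \<open>All constants are fixed before \<open>n\<close>, \<open>B\<close> and \<open>f\<close>.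
  Hence the locale operations appear with explicit parameters, and the locale is interpreted only
  inside the proof.\<close>

lemma Bernoulli_X_p_constant:
  fixes p :: real
  assumes p: "2 \<le> p"
  obtains K where "0 < K"
    and "\<And>n (B :: 'b set) f \<delta>. finite_product B \<Longrightarrow> finite_product.mean n B f = 0 \<Longrightarrow> 0 \<le> \<delta> \<Longrightarrow> \<delta> \<le> 1 \<Longrightarrow>
      bernoulli_sum \<delta> n (\<lambda>S. finite_product.mean n B (\<lambda>x. \<bar>finite_product.cexp n B S f x\<bar> powr p))
      \<le> K * (\<delta> * (\<Sum>j=1..n. finite_product.mean n B (\<lambda>x. \<bar>f x - finite_product.cexp n B ({1..n} - {j}) f x\<bar> powr p))
         + \<delta> powr (p / 2) * finite_product.mean n B (\<lambda>x. \<bar>f x\<bar> powr p))"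
proof -
  obtain Ct where Ct: "0 < Ct" "\<And>a d. \<bar>a + d\<bar> powr p \<le> \<bar>a\<bar> powr p + p * (sgn a * \<bar>a\<bar> powr (p - 1)) * d
           + Ct * (\<bar>a\<bar> powr (p - 2) * d\<^sup>2 + \<bar>d\<bar> powr p)"
    using powr_second_order[OF p] by blast
  obtain Cd where Cd: "0 < Cd" "\<And>u v :: real. 0 \<le> u \<Longrightarrow> 0 \<le> v \<Longrightarrow> u powr (p - 1) * v \<le> 1/4 * u powr p + Cd * v powr p"
    using powr_Young[of "1/4" "p - 1" 1] p by auto
  \<comment> \<open>The coefficient \<open>1/p\<close> becomes the required 1/2 after multiplication
    by \<open>p / 2\<close>.\<close>
  obtain C where C: "0 < C" "\<And>u v :: real. 0 \<le> u \<Longrightarrow> 0 \<le> v \<Longrightarrow> u powr (p / 2 - 1) * v \<le> 1/p * u powr (p / 2) + C * v powr (p / 2)"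
    using powr_Young[of "1 / p" "p / 2 - 1" 1] p by auto
  define Cs where "Cs = p / 2 * C"
  have Cs: "p / 2 * (u powr (p / 2 - 1) * v) \<le> 1/2 * u powr (p / 2) + Cs * v powr (p / 2)" if "0 \<le> u" "0 \<le> v" for u v
    using mult_left_mono[OF C(2)[OF that], of "p / 2"] p by (simp add: Cs_def algebra_simps)
  define \<epsilon> where "\<epsilon> = 1 / (8 * Ct * Cd)"
  have \<epsilon>: "0 < \<epsilon>" "Ct * (4 * \<epsilon> * Cd) = 1/2" using Ct Cd by (auto simp: \<epsilon>_def)
  \<comment> \<open>Young's inequality with exponents \<open>p - 2\<close> and 2 is later used at
    \<open>v = w powr (1/2)\<close>.\<close>
  obtain Cy where Cy: "0 < Cy" "\<And>u v :: real. 0 \<le> u \<Longrightarrow> 0 \<le> v \<Longrightarrow> u powr (p - 2) * v powr 2 \<le> \<epsilon> * u powr p + Cy * v powr p"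
    using powr_Young[of \<epsilon> "p - 2" 2] p \<epsilon> by auto
  have Cy': "u powr (p - 2) * w \<le> \<epsilon> * u powr p + Cy * w powr (p / 2)" if "0 \<le> u" "0 \<le> w" for u w
    using Cy(2)[of u "w powr (1/2)"] that by (simp add: powr_powr)
  let ?K = "2 * Ct + 4 * Ct * Cy * Cs"
  have K: "0 < ?K" using Ct Cy C p by (simp add: Cs_def add_pos_pos)
  show ?thesis
  proof (rule that[OF K])
    fix n :: nat and B :: "'b set" and f :: "(nat \<Rightarrow> 'b) \<Rightarrow> real" and \<delta> :: real
    assume "finite_product B"
    then interpret finite_product n B .
    assume f: "mean f = 0" and \<delta>: "0 \<le> \<delta>" "\<delta> \<le> 1"
    let ?b = "\<delta> * (\<Sum>j=1..n. mean (\<lambda>x. \<bar>f x - cexp ({1..n} - {j}) f x\<bar> powr p))"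
    let ?a = "\<delta> powr (p / 2) * mean (\<lambda>x. \<bar>f x\<bar> powr p)"
    have nn: "0 \<le> ?b" "0 \<le> ?a" using \<delta> by (auto intro!: mult_nonneg_nonneg sum_nonneg mean_nonneg)
    have "bernoulli_sum \<delta> n (\<lambda>S. mean (\<lambda>x. \<bar>cexp S f x\<bar> powr p)) \<le> 2 * Ct * ?b + 4 * Ct * Cy * Cs * ?a"
      by (rule bernoulli_mean_powr_le[OF p \<delta> f _ _ _ Ct(2) Cd(2) Cs Cy' \<epsilon>(2)]) (use \<epsilon> Cy Ct in auto)
    also have "\<dots> \<le> ?K * (?b + ?a)"
      using nn Ct(1) Cy(1) C(1) p by (auto simp: distrib_left Cs_def intro!: add_mono mult_right_mono)
    finally show "bernoulli_sum \<delta> n (\<lambda>S. mean (\<lambda>x. \<bar>cexp S f x\<bar> powr p)) \<le> ?K * (?b + ?a)" .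
  qed
qed

lemma norm_powr_le_Re_Im:
  fixes p :: real
  assumes "0 \<le> p"
  shows "norm z powr p \<le> 2 powr p * (\<bar>Re z\<bar> powr p + \<bar>Im z\<bar> powr p)"
proof -
  have "norm z \<le> 2 * max \<bar>Re z\<bar> \<bar>Im z\<bar>" using cmod_le[of z] by linarith
  then have "norm z powr p \<le> (2 * max \<bar>Re z\<bar> \<bar>Im z\<bar>) powr p" using assms by (intro powr_mono2) auto
  also have "\<dots> = 2 powr p * max \<bar>Re z\<bar> \<bar>Im z\<bar> powr p" by (rule powr_mult)
  also have "\<dots> \<le> 2 powr p * (\<bar>Re z\<bar> powr p + \<bar>Im z\<bar> powr p)"
    by (intro mult_left_mono) (auto simp: max_def)
  finally show ?thesis .
qed

text \<open>The real estimate is applied to \<open>Re\<close> and \<open>Im\<close>, which commute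
  with averaging; \<open>part\<close> stands for either.\<close>

lemma X_p_constant:
  fixes p :: real
  assumes p: "2 \<le> p"
  obtains K where "0 < K"
    and "\<And>n (B :: 'b set) (f :: (nat \<Rightarrow> 'b) \<Rightarrow> complex) k. finite_product B \<Longrightarrow> k \<in> {1..n} \<Longrightarrow> finite_product.mean n B f = 0 \<Longrightarrow>
      subset_average n k (\<lambda>S. finite_product.mean n B (\<lambda>x. norm (finite_product.cexp n B S f x) powr p))
      \<le> K * (real k / real n * (\<Sum>j=1..n. finite_product.mean n B (\<lambda>x. norm (f x - finite_product.cexp n B ({1..n} - {j}) f x) powr p))
         + (real k / real n) powr (p / 2) * finite_product.mean n B (\<lambda>x. norm (f x) powr p))"
proof -
  obtain K where K: "0 < K" and bern: "\<And>n (B :: 'b set) f \<delta>. finite_product B \<Longrightarrow> finite_product.mean n B f = 0 \<Longrightarrow> 0 \<le> \<delta> \<Longrightarrow> \<delta> \<le> 1 \<Longrightarrow>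
      bernoulli_sum \<delta> n (\<lambda>S. finite_product.mean n B (\<lambda>x. \<bar>finite_product.cexp n B S f x\<bar> powr p))
      \<le> K * (\<delta> * (\<Sum>j=1..n. finite_product.mean n B (\<lambda>x. \<bar>f x - finite_product.cexp n B ({1..n} - {j}) f x\<bar> powr p))
         + \<delta> powr (p / 2) * finite_product.mean n B (\<lambda>x. \<bar>f x\<bar> powr p))"
    using Bernoulli_X_p_constant[OF p] by blast
  define K' where "K' = (2 * K + 1) * 2 powr (p / 2)"
  have K': "0 < K'" using K by (simp add: K'_def)
  show ?thesis
  proof (rule that)
    show "0 < 2 powr p * (2 * K')" using K' by simp
    fix n k :: nat and B :: "'b set" and f :: "(nat \<Rightarrow> 'b) \<Rightarrow> complex"
    assume fp: "finite_product B"
    then interpret finite_product n B .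
    assume k: "k \<in> {1..n}" and f: "mean f = 0"
    let ?q = "real k / real n"
    let ?R = "?q * (\<Sum>j=1..n. mean (\<lambda>x. norm (f x - cexp ({1..n} - {j}) f x) powr p)) + ?q powr (p / 2) * mean (\<lambda>x. norm (f x) powr p)"
    have part: "subset_average n k (\<lambda>S. mean (\<lambda>x. \<bar>part (cexp S f x)\<bar> powr p)) \<le> K' * ?R"
      if diff: "\<And>z w. part (z - w) = part z - part w" and le: "\<And>z. \<bar>part z\<bar> \<le> norm z"
        and comm: "\<And>S x. part (cexp S f x) = cexp S (\<lambda>x. part (f x)) x"
        and mean0: "mean (\<lambda>x. part (f x)) = 0" for part :: "complex \<Rightarrow> real"
    proof -
      let ?f = "\<lambda>x. part (f x)"
      have "subset_average n k (\<lambda>S. mean (\<lambda>x. \<bar>cexp S ?f x\<bar> powr p))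
        \<le> K' * (?q * (\<Sum>j=1..n. mean (\<lambda>x. \<bar>?f x - cexp ({1..n} - {j}) ?f x\<bar> powr p)) + ?q powr (p / 2) * mean (\<lambda>x. \<bar>?f x\<bar> powr p))"
        unfolding K'_def
        by (rule subset_average_mean_powr_le[OF p K k bern[OF fp mean0]]) (auto intro!: sum_nonneg mean_nonneg)
      also have "\<dots> \<le> K' * ?R"
        unfolding comm[symmetric] diff[symmetric] using K' p le
        by (intro mult_left_mono add_mono sum_mono mean_mono powr_mono2) auto
      finally show ?thesis by (simp only: comm)
    qed
    have "subset_average n k (\<lambda>S. mean (\<lambda>x. norm (cexp S f x) powr p))
      \<le> subset_average n k (\<lambda>S. mean (\<lambda>x. 2 powr p * (\<bar>Re (cexp S f x)\<bar> powr p + \<bar>Im (cexp S f x)\<bar> powr p)))"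
      using p by (intro subset_average_mono mean_mono norm_powr_le_Re_Im) auto
    also have "\<dots> = 2 powr p * (subset_average n k (\<lambda>S. mean (\<lambda>x. \<bar>Re (cexp S f x)\<bar> powr p))
        + subset_average n k (\<lambda>S. mean (\<lambda>x. \<bar>Im (cexp S f x)\<bar> powr p)))"
      by (simp only: mean_cmult mean_add subset_average_cmult subset_average_add)
    also have "\<dots> \<le> 2 powr p * (K' * ?R + K' * ?R)"
      using f by (intro mult_left_mono add_mono part)
        (auto simp: Re_cexp Im_cexp abs_Re_le_cmod abs_Im_le_cmod Re_mean[symmetric] Im_mean[symmetric])
    also have "\<dots> = 2 powr p * (2 * K') * ?R" by simp
    finally show "subset_average n k (\<lambda>S. mean (\<lambda>x. norm (cexp S f x) powr p)) \<le> 2 powr p * (2 * K') * ?R" .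
  qed
qed

section \<open>Fourier multipliers\<close>

text \<open>Independence of the coordinates: each resampled factor is averaged separately.\<close>

lemma (in finite_product) cexp_prod:
  fixes u :: "nat \<Rightarrow> 'b \<Rightarrow> 'c::real_normed_field"
  shows "cexp S (\<lambda>x. \<Prod>i=1..n. u i (x i)) x =
    (\<Prod>i=1..n. if i \<in> S then u i (x i) else (\<Sum>a\<in>B. u i a) / of_nat (card B))"
proof -
  let ?v = "\<lambda>i a. if i \<in> S then u i (x i) else u i a"
  have cB: "of_nat (card B) \<noteq> (0 :: 'c)" using finite_B nonempty_B by simp
  have "cexp S (\<lambda>x. \<Prod>i=1..n. u i (x i)) x = (\<Sum>y\<in>{1..n} \<rightarrow>\<^sub>E B. \<Prod>i=1..n. ?v i (y i)) / of_nat (card B) ^ n"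
  proof -
    have "u i (merge S x y i) = ?v i (y i)" for i y by (simp add: merge_def)
    then show ?thesis by (simp add: cexp_def mean_def \<Omega>_def card_PiE)
  qed
  also have "(\<Sum>y\<in>{1..n} \<rightarrow>\<^sub>E B. \<Prod>i=1..n. ?v i (y i)) = (\<Prod>i=1..n. \<Sum>a\<in>B. ?v i a)"
    by (rule prod_sum_PiE[symmetric]) (auto simp: finite_B)
  also have "\<dots> / of_nat (card B) ^ n = (\<Prod>i=1..n. (\<Sum>a\<in>B. ?v i a) / of_nat (card B))"
    by (simp add: prod_dividef)
  also have "\<dots> = (\<Prod>i=1..n. if i \<in> S then u i (x i) else (\<Sum>a\<in>B. u i a) / of_nat (card B))"
    using cB by (intro prod.cong refl) auto
  finally show ?thesis .
qed

definition unit_exp :: "nat \<Rightarrow> int \<Rightarrow> complex" where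
  "unit_exp m z = exp (of_real pi * \<i> / of_nat m * of_int z)"

lemma unit_exp_add: "unit_exp m (a + b) = unit_exp m a * unit_exp m b"
  by (simp add: unit_exp_def exp_add[symmetric] ring_distribs)

lemma unit_exp_0 [simp]: "unit_exp m 0 = 1"
  by (simp add: unit_exp_def)

lemma norm_unit_exp [simp]: "norm (unit_exp m z) = 1"
  by (simp add: unit_exp_def)

lemma character_eq_prod: "character m n g x = (\<Prod>i=1..n. unit_exp m (x i * g i))"
  by (simp add: character_def pairing_def unit_exp_def sum_distrib_left exp_sum)

section \<open>Averages as Fourier projections on the group\<close>

locale even_cyclic_power =
  fixes m n :: nat
  assumes m_pos: "1 \<le> m"

sublocale even_cyclic_power \<subseteq> finite_product n "{0..<2 * int m}"
  using m_pos by unfold_locales auto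

context even_cyclic_power
begin

lemma carrier_eq: "carrier (Zpow m n) = \<Omega>"
  using m_pos by (simp add: carrier_Zpow \<Omega>_def)

lemma card_\<Omega>: "card \<Omega> = (2 * m) ^ n"
  using card_carrier_Zpow[OF m_pos, of n] by (simp add: carrier_eq)

lemma Lp_norm_powr:
  assumes "0 < p"
  shows "Lp_norm m n p f powr p = mean (\<lambda>x. norm (f x) powr p)"
proof -
  have "Lp_norm m n p f = mean (\<lambda>x. norm (f x) powr p) powr (1 / p)"
    by (simp add: Lp_norm_eq[OF m_pos] mean_def carrier_eq card_\<Omega>)
  moreover have "0 \<le> mean (\<lambda>x. norm (f x) powr p)" by (intro mean_nonneg) simp
  ultimately show ?thesis using assms by (simp add: powr_powr)
qed

lemma coordinate_bounds:
  assumes "g \<in> \<Omega>" "i \<in> {1..n}"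
  shows "0 \<le> g i" "g i < 2 * int m"
  using assms by (auto simp: \<Omega>_def PiE_iff)

lemma fourier_coeff_mean: "fourier_coeff m n f g = mean (\<lambda>x. f x * cnj (character m n g x))"
  by (simp add: fourier_coeff_eq[OF m_pos] mean_def carrier_eq card_\<Omega>)

lemma fourier_coeff_zero: "fourier_coeff m n f (\<lambda>j\<in>{1..n}. 0) = mean f"
proof -
  have "character m n (\<lambda>j\<in>{1..n}. 0) x = 1" for x by (simp add: character_eq_prod)
  then show ?thesis by (simp add: fourier_coeff_mean)
qed

lemma sum_unit_exp:
  assumes "\<bar>z\<bar> < 2 * int m"
  shows "(\<Sum>a\<in>{0..<2 * int m}. unit_exp m (a * z)) / of_nat (card {0..<2 * int m}) = of_bool (z = 0)"
  using sum_roots_of_unity_2m[OF m_pos assms] m_pos by (simp add: unit_exp_def)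

text \<open>Each coordinate outside \<open>S\<close> contributes a full sum of roots of unity, which
  vanishes unless that frequency is 0.\<close>

lemma cexp_character:
  assumes "g \<in> \<Omega>" "x \<in> \<Omega>"
  shows "cexp S (character m n g) x = of_bool (\<forall>i\<in>{1..n} - S. g i = 0) * character m n g x"
proof -
  have g: "\<bar>g i\<bar> < 2 * int m" if "i \<in> {1..n}" for i
    using coordinate_bounds[OF assms(1) that] by simp
  have "cexp S (character m n g) x = cexp S (\<lambda>x. \<Prod>i=1..n. unit_exp m (x i * g i)) x"
    by (simp add: character_eq_prod[abs_def])
  also have "\<dots> = (\<Prod>i=1..n. if i \<in> S then unit_exp m (x i * g i)
      else (\<Sum>a\<in>{0..<2 * int m}. unit_exp m (a * g i)) / of_nat (card {0..<2 * int m}))"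
    by (rule cexp_prod)
  also have "\<dots> = (\<Prod>i=1..n. of_bool (i \<in> S \<or> g i = 0) * unit_exp m (x i * g i))"
  proof (intro prod.cong refl)
    fix i assume "i \<in> {1..n}"
    from sum_unit_exp[OF g[OF this]]
    show "(if i \<in> S then unit_exp m (x i * g i)
        else (\<Sum>a\<in>{0..<2 * int m}. unit_exp m (a * g i)) / of_nat (card {0..<2 * int m}))
      = of_bool (i \<in> S \<or> g i = 0) * unit_exp m (x i * g i)"
      by (cases "i \<in> S"; cases "g i = 0") simp_all
  qed
  also have "\<dots> = (\<Prod>i=1..n. of_bool (i \<in> S \<or> g i = 0)) * character m n g x"
    by (simp only: prod.distrib character_eq_prod)
  also have "(\<Prod>i=1..n. of_bool (i \<in> S \<or> g i = 0)) = (of_bool (\<forall>i\<in>{1..n} - S. g i = 0) :: complex)"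
    by (cases "\<forall>i\<in>{1..n} - S. g i = 0") (auto intro!: prod.neutral prod_zero)
  finally show ?thesis .
qed

text \<open>Identifies the restricted Fourier sum of the theorem with \<open>cexp S f\<close>,
  turning the first inequality into a statement about averages.\<close>

lemma cexp_fourier:
  assumes "x \<in> \<Omega>"
  shows "cexp S f x = (\<Sum>g\<in>Zsub m n S. fourier_coeff m n f g * character m n g x)"
proof -
  have "cexp S f x = cexp S (\<lambda>x. \<Sum>g\<in>\<Omega>. fourier_coeff m n f g * character m n g x) x"
    using fourier_inversion[OF m_pos, of _ n f] assms by (intro cexp_cong) (auto simp only: carrier_eq)
  also have "\<dots> = (\<Sum>g\<in>\<Omega>. fourier_coeff m n f g * cexp S (character m n g) x)"
    by (simp only: cexp_sum cexp_cmult)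
  also have "\<dots> = (\<Sum>g\<in>\<Omega>. if \<forall>i\<in>{1..n} - S. g i = 0 then fourier_coeff m n f g * character m n g x else 0)"
    using assms by (intro sum.cong refl) (auto simp: cexp_character)
  also have "\<dots> = (\<Sum>g\<in>Zsub m n S. fourier_coeff m n f g * character m n g x)"
    unfolding Zsub_def carrier_eq by (rule sum.inter_filter[symmetric]) (rule finite_\<Omega>)
  finally show ?thesis .
qed

lemma fourier_coeff_multiplier:
  assumes "g \<in> \<Omega>"
  shows "fourier_coeff m n (multiplier m n \<phi> f) g = \<phi> g * fourier_coeff m n f g"
proof -
  have "fourier_coeff m n (multiplier m n \<phi> f) g =
      mean (\<lambda>x. \<Sum>h\<in>\<Omega>. \<phi> h * fourier_coeff m n f h * (character m n h x * cnj (character m n g x)))"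
    unfolding fourier_coeff_mean[of "multiplier m n \<phi> f"]
    by (intro mean_cong) (simp only: multiplier_def carrier_eq sum_distrib_right mult.assoc)
  also have "\<dots> = (\<Sum>h\<in>\<Omega>. \<phi> h * fourier_coeff m n f h * mean (\<lambda>x. character m n h x * cnj (character m n g x)))"
    by (simp only: mean_sum mean_cmult)
  also have "\<dots> = (\<Sum>h\<in>\<Omega>. \<phi> h * fourier_coeff m n f h * of_bool (g = h))"
  proof (intro sum.cong refl)
    fix h assume "h \<in> \<Omega>"
    then have "mean (\<lambda>x. character m n h x * cnj (character m n g x)) = of_bool (g = h)"
      using fourier_coeff_character[OF m_pos, of g n h] assms by (simp only: carrier_eq fourier_coeff_mean)
    then show "\<phi> h * fourier_coeff m n f h * mean (\<lambda>x. character m n h x * cnj (character m n g x))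
        = \<phi> h * fourier_coeff m n f h * of_bool (g = h)" by simp
  qed
  also have "\<dots> = \<phi> g * fourier_coeff m n f g"
    using assms finite_\<Omega> by simp
  finally show ?thesis .
qed

lemma partial_deriv_eq:
  assumes "j \<in> {1..n}" "x \<in> \<Omega>"
  shows "partial_deriv m n j f x = f x - cexp ({1..n} - {j}) f x"
proof -
  have "f x - cexp ({1..n} - {j}) f x = (\<Sum>g\<in>\<Omega>. fourier_coeff m n f g * character m n g x)
      - (\<Sum>g\<in>\<Omega>. if g j = 0 then fourier_coeff m n f g * character m n g x else 0)"
  proof -
    have "Zsub m n ({1..n} - {j}) = {g \<in> \<Omega>. g j = 0}"
      using assms by (auto simp: Zsub_def carrier_eq)
    then show ?thesis
      using fourier_inversion[OF m_pos, of x n f] assms(2)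
      by (simp add: cexp_fourier carrier_eq sum.inter_filter[OF finite_\<Omega>])
  qed
  also have "\<dots> = partial_deriv m n j f x"
    unfolding partial_deriv_def multiplier_def carrier_eq sum_subtractf[symmetric]
    by (intro sum.cong refl) auto
  finally show ?thesis by simp
qed

text \<open>The projection onto one frequency of coordinate \<open>j\<close> is averaging conjugated
  by unimodular factors, hence an L_p contraction for every \<open>b\<close>.\<close>

lemma multiplier_frequency_eq:
  assumes j: "j \<in> {1..n}" and b: "0 \<le> b" "b < 2 * int m" and x: "x \<in> \<Omega>"
  shows "multiplier m n (\<lambda>g. of_bool (g j = b)) f x =
    unit_exp m (x j * b) * cexp ({1..n} - {j}) (\<lambda>y. unit_exp m (- (y j * b)) * f y) x"
proof -
  let ?S = "{1..n} - {j}" and ?e = "\<lambda>y. unit_exp m (- (y j * b))"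
  have char: "cexp ?S (\<lambda>y. ?e y * character m n g y) x = of_bool (g j = b) * (?e x * character m n g x)"
    if g: "g \<in> \<Omega>" for g
  proof -
    let ?h = "\<lambda>i. if i = j then g j - b else g i"
    \<comment> \<open>the twist shifts the \<open>j\<close>-th frequency from \<open>b\<close> to \<open>0\<close>\<close>
    have e: "?e y * character m n g y = (\<Prod>i=1..n. unit_exp m (y i * ?h i))" for y
    proof -
      have "(\<Prod>i=1..n. unit_exp m (y i * ?h i)) = unit_exp m (y j * (g j - b)) * (\<Prod>i\<in>?S. unit_exp m (y i * ?h i))"
        using j by (subst prod.remove[of _ j]) auto
      also have "(\<Prod>i\<in>?S. unit_exp m (y i * ?h i)) = (\<Prod>i\<in>?S. unit_exp m (y i * g i))"
        by (intro prod.cong refl) auto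
      also have "unit_exp m (y j * (g j - b)) = ?e y * unit_exp m (y j * g j)"
        by (simp add: unit_exp_add[symmetric] algebra_simps)
      finally show ?thesis
        unfolding character_eq_prod using j by (subst prod.remove[of _ j]) auto
    qed
    have gb: "\<bar>g j - b\<bar> < 2 * int m" using coordinate_bounds[OF g j] b by simp
    have "cexp ?S (\<lambda>y. ?e y * character m n g y) x =
        (\<Prod>i=1..n. if i \<in> ?S then unit_exp m (x i * ?h i)
          else (\<Sum>a\<in>{0..<2 * int m}. unit_exp m (a * ?h i)) / of_nat (card {0..<2 * int m}))"
      unfolding e by (rule cexp_prod)
    also have "\<dots> = (\<Prod>i=1..n. (if i = j then of_bool (g j = b) else 1) * unit_exp m (x i * ?h i))"
      using sum_unit_exp[OF gb] by (intro prod.cong refl) auto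
    also have "\<dots> = of_bool (g j = b) * (\<Prod>i=1..n. unit_exp m (x i * ?h i))"
      using j by (simp only: prod.distrib) (simp add: prod.delta)
    finally show ?thesis by (simp only: e)
  qed
  have "cexp ?S (\<lambda>y. ?e y * f y) x = cexp ?S (\<lambda>y. \<Sum>g\<in>\<Omega>. fourier_coeff m n f g * (?e y * character m n g y)) x"
  proof (rule cexp_cong[OF _ x])
    fix y assume "y \<in> \<Omega>"
    then have "f y = (\<Sum>g\<in>\<Omega>. fourier_coeff m n f g * character m n g y)"
      using fourier_inversion[OF m_pos, of y n f] by (simp only: carrier_eq)
    then show "?e y * f y = (\<Sum>g\<in>\<Omega>. fourier_coeff m n f g * (?e y * character m n g y))"
      by (simp add: sum_distrib_left mult_ac)
  qed
  also have "\<dots> = (\<Sum>g\<in>\<Omega>. fourier_coeff m n f g * (of_bool (g j = b) * (?e x * character m n g x)))"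
    using char by (simp add: cexp_sum cexp_cmult)
  also have "\<dots> = ?e x * multiplier m n (\<lambda>g. of_bool (g j = b)) f x"
    by (simp add: multiplier_def carrier_eq sum_distrib_left mult_ac)
  also have "unit_exp m (x j * b) * \<dots> = multiplier m n (\<lambda>g. of_bool (g j = b)) f x"
    by (simp add: mult.assoc[symmetric] unit_exp_add[symmetric])
  finally show ?thesis by simp
qed

lemma mean_multiplier_frequency_le:
  assumes "1 \<le> p" "j \<in> {1..n}" "0 \<le> b" "b < 2 * int m"
  shows "mean (\<lambda>x. norm (multiplier m n (\<lambda>g. of_bool (g j = b)) f x) powr p) \<le> mean (\<lambda>x. norm (f x) powr p)"
proof -
  let ?h = "\<lambda>y. unit_exp m (- (y j * b)) * f y"
  have "mean (\<lambda>x. norm (multiplier m n (\<lambda>g. of_bool (g j = b)) f x) powr p)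
      = mean (\<lambda>x. norm (cexp ({1..n} - {j}) ?h x) powr p)"
    using assms by (intro mean_cong) (simp add: multiplier_frequency_eq norm_mult)
  also have "\<dots> \<le> mean (\<lambda>x. norm (?h x) powr p)" by (rule mean_norm_cexp_powr_le[OF assms(1)])
  finally show ?thesis by (simp add: norm_mult)
qed

text \<open>The two frequency windows, from 1 to \<open>m\<close> and from \<open>m\<close> to
  \<open>2m - 1\<close>, cover the nonzero frequencies and overlap exactly at
  \<open>m\<close>.\<close>

lemma partial_u_sum_eq:
  assumes "j \<in> {1..n}"
  shows "partial_u m n j 1 f x + partial_u m n j m f x =
    multiplier m n (\<lambda>g. 2 * of_real pi * \<i> * (of_bool (g j \<noteq> 0) + of_bool (g j = int m))) f x"
proof -
  have "2 * of_real pi * \<i> * of_bool (int 1 \<le> g j \<and> g j < int 1 + int m)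
      + 2 * of_real pi * \<i> * of_bool (int m \<le> g j \<and> g j < int m + int m)
      = (2 * of_real pi * \<i> * (of_bool (g j \<noteq> 0) + of_bool (g j = int m)) :: complex)" if "g \<in> \<Omega>" for g
  proof -
    have "0 \<le> g j" "g j < 2 * int m" using coordinate_bounds[OF that assms] by auto
    then show ?thesis by (auto simp: of_bool_def)
  qed
  then show ?thesis
    unfolding partial_u_def multiplier_def carrier_eq sum.distrib[symmetric] distrib_right[symmetric]
    by (intro sum.cong refl) (simp only: mult.assoc)
qed

lemma mean_partial_deriv_le:
  assumes p: "1 \<le> p" and j: "j \<in> {1..n}"
  shows "mean (\<lambda>x. norm (partial_deriv m n j f x) powr p)
    \<le> 2 * mean (\<lambda>x. norm (partial_u m n j 1 f x + partial_u m n j m f x) powr p)"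
proof -
  define \<phi> :: "(nat \<Rightarrow> int) \<Rightarrow> complex" where "\<phi> g = 2 * of_real pi * \<i> * (of_bool (g j \<noteq> 0) + of_bool (g j = int m))" for g
  let ?T = "multiplier m n \<phi> f" and ?P = "multiplier m n (\<lambda>g. of_bool (g j = int m))"
  \<comment> \<open>At frequency \<open>m\<close> the symbol \<phi> is doubled; subtracting half of
    the projection corrects this and changes nothing elsewhere.\<close>
  have eq: "partial_deriv m n j f x = (?T x - ?P ?T x / 2) / (2 * of_real pi * \<i>)" for x
  proof -
    have "?T x - ?P ?T x / 2 = (\<Sum>g\<in>\<Omega>. (\<phi> g - of_bool (g j = int m) * \<phi> g / 2) * fourier_coeff m n f g * character m n g x)"
      unfolding multiplier_def[of m n _ _ x] carrier_eq
      by (simp add: fourier_coeff_multiplier sum_divide_distrib sum_subtractf[symmetric] algebra_simps cong: sum.cong)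
    also have "\<dots> = (\<Sum>g\<in>\<Omega>. 2 * of_real pi * \<i> * (of_bool (g j \<noteq> 0) * fourier_coeff m n f g * character m n g x))"
      using m_pos by (intro sum.cong refl) (auto simp: \<phi>_def)
    also have "\<dots> = 2 * of_real pi * \<i> * partial_deriv m n j f x"
      by (simp add: partial_deriv_def multiplier_def carrier_eq sum_distrib_left)
    finally show ?thesis by simp
  qed
  have "norm (partial_deriv m n j f x) powr p \<le> norm (?T x) powr p + norm (?P ?T x) powr p" for x
  proof -
    have "norm (partial_deriv m n j f x) = norm (?T x - ?P ?T x / 2) / (2 * pi)"
      by (simp add: eq norm_divide norm_mult)
    also have "\<dots> \<le> norm (?T x - ?P ?T x / 2) / 2"
      using pi_gt3 by (intro divide_left_mono) auto
    also have "\<dots> \<le> (norm (?T x) + norm (?P ?T x) / 2) / 2"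
      using norm_triangle_ineq4[of "?T x" "?P ?T x / 2"] by (simp add: norm_divide)
    \<comment> \<open>Passing to the maximum, whose p-th power is at most the sum of the p-th
      powers, gives a constant independent of \<open>p\<close>.\<close>
    also have "\<dots> \<le> max (norm (?T x)) (norm (?P ?T x))"
      using norm_ge_zero[of "?T x"] max.cobounded1[of "norm (?T x)" "norm (?P ?T x)"]
        max.cobounded2[of "norm (?P ?T x)" "norm (?T x)"] by argo
    finally have "norm (partial_deriv m n j f x) powr p \<le> max (norm (?T x)) (norm (?P ?T x)) powr p"
      using p by (intro powr_mono2) auto
    then show ?thesis by (auto simp: max_def split: if_splits intro: order_trans)
  qed
  then have "mean (\<lambda>x. norm (partial_deriv m n j f x) powr p) \<le> mean (\<lambda>x. norm (?T x) powr p + norm (?P ?T x) powr p)"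
    by (intro mean_mono)
  also have "\<dots> \<le> mean (\<lambda>x. norm (?T x) powr p) + mean (\<lambda>x. norm (?T x) powr p)"
    using mean_multiplier_frequency_le[OF p j, of "int m" ?T] m_pos by (simp add: mean_add)
  finally show ?thesis by (simp only: partial_u_sum_eq[OF j] \<phi>_def[abs_def] mult_2)
qed

end

theorem mainTheorem7:
  shows "\<forall>p::real. 2 \<le> p \<longrightarrow> (\<exists>C::real. C > 0 \<and>
    (\<forall>(m::nat) (n::nat) (k::nat) (f::(nat \<Rightarrow> int) \<Rightarrow> complex).
      1 \<le> m \<longrightarrow> 1 \<le> n \<longrightarrow> k \<in> {1..n} \<longrightarrow> fourier_coeff m n f (\<lambda>j\<in>{1..n}. 0) = 0 \<longrightarrow>
        1 / real (n choose k) *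
          (\<Sum>S | S \<subseteq> {1..n} \<and> card S = k.
            Lp_norm m n p (\<lambda>x. \<Sum>g\<in>Zsub m n S. fourier_coeff m n f g * character m n g x) powr p)
        \<le> C * (real k / real n * (\<Sum>j=1..n. Lp_norm m n p (partial_deriv m n j f) powr p)
               + (real k / real n) powr (p / 2) * Lp_norm m n p f powr p)
      \<and>
        real k / real n * (\<Sum>j=1..n. Lp_norm m n p (partial_deriv m n j f) powr p)
          + (real k / real n) powr (p / 2) * Lp_norm m n p f powr p
        \<le> C * (real k / real n *
                 (\<Sum>j=1..n. Lp_norm m n p (\<lambda>x. partial_u m n j 1 f x + partial_u m n j m f x) powr p)
               + (real k / real n) powr (p / 2) * Lp_norm m n p f powr p)))"
proof (intro allI impI)
  fix p :: real
  assume p: "2 \<le> p"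
  obtain K where K: "0 < K"
    and X_p: "\<And>n B (f :: (nat \<Rightarrow> int) \<Rightarrow> complex) k. finite_product B \<Longrightarrow> k \<in> {1..n} \<Longrightarrow> finite_product.mean n B f = 0 \<Longrightarrow>
      subset_average n k (\<lambda>S. finite_product.mean n B (\<lambda>x. norm (finite_product.cexp n B S f x) powr p))
      \<le> K * (real k / real n * (\<Sum>j=1..n. finite_product.mean n B (\<lambda>x. norm (f x - finite_product.cexp n B ({1..n} - {j}) f x) powr p))
         + (real k / real n) powr (p / 2) * finite_product.mean n B (\<lambda>x. norm (f x) powr p))"
    using X_p_constant[OF p] by blast
  show "\<exists>C::real. C > 0 \<and>
    (\<forall>(m::nat) (n::nat) (k::nat) (f::(nat \<Rightarrow> int) \<Rightarrow> complex).
      1 \<le> m \<longrightarrow> 1 \<le> n \<longrightarrow> k \<in> {1..n} \<longrightarrow> fourier_coeff m n f (\<lambda>j\<in>{1..n}. 0) = 0 \<longrightarrow>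
        1 / real (n choose k) *
          (\<Sum>S | S \<subseteq> {1..n} \<and> card S = k.
            Lp_norm m n p (\<lambda>x. \<Sum>g\<in>Zsub m n S. fourier_coeff m n f g * character m n g x) powr p)
        \<le> C * (real k / real n * (\<Sum>j=1..n. Lp_norm m n p (partial_deriv m n j f) powr p)
               + (real k / real n) powr (p / 2) * Lp_norm m n p f powr p)
      \<and>
        real k / real n * (\<Sum>j=1..n. Lp_norm m n p (partial_deriv m n j f) powr p)
          + (real k / real n) powr (p / 2) * Lp_norm m n p f powr p
        \<le> C * (real k / real n *
                 (\<Sum>j=1..n. Lp_norm m n p (\<lambda>x. partial_u m n j 1 f x + partial_u m n j m f x) powr p)
               + (real k / real n) powr (p / 2) * Lp_norm m n p f powr p))"
  \<comment> \<open>\<open>K\<close> serves the first inequality, and 2, from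
    \<open>mean_partial_deriv_le\<close>, the second.\<close>
  proof (rule exI[of _ "K + 2"], intro conjI allI impI)
    show "0 < K + 2" using K by simp
  next
    fix m n k :: nat and f :: "(nat \<Rightarrow> int) \<Rightarrow> complex"
    assume m: "1 \<le> m" and k: "k \<in> {1..n}" and f: "fourier_coeff m n f (\<lambda>j\<in>{1..n}. 0) = 0"
    interpret even_cyclic_power m n using m by unfold_locales
    let ?q = "real k / real n"
    let ?D = "\<Sum>j=1..n. Lp_norm m n p (partial_deriv m n j f) powr p"
    let ?U = "\<Sum>j=1..n. Lp_norm m n p (\<lambda>x. partial_u m n j 1 f x + partial_u m n j m f x) powr p"
    let ?A = "?q powr (p / 2) * Lp_norm m n p f powr p"
    have nn: "0 \<le> ?q" "0 \<le> ?D" "0 \<le> ?U" "0 \<le> ?A" by (auto intro!: sum_nonneg)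
    have Lp: "Lp_norm m n p h powr p = mean (\<lambda>x. norm (h x) powr p)" for h
      using p by (intro Lp_norm_powr) simp
    have S: "Lp_norm m n p (\<lambda>x. \<Sum>g\<in>Zsub m n S. fourier_coeff m n f g * character m n g x) powr p
        = mean (\<lambda>x. norm (cexp S f x) powr p)" for S
      unfolding Lp by (intro mean_cong) (simp add: cexp_fourier)
    have D: "(\<Sum>j=1..n. mean (\<lambda>x. norm (f x - cexp ({1..n} - {j}) f x) powr p)) = ?D"
      unfolding Lp by (intro sum.cong mean_cong refl) (simp add: partial_deriv_eq)
    have "subset_average n k (\<lambda>S. mean (\<lambda>x. norm (cexp S f x) powr p)) \<le> K * (?q * ?D + ?A)"
      using X_p[OF finite_product_axioms k f[unfolded fourier_coeff_zero]] by (simp only: D Lp[of f, symmetric])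
    also have "\<dots> \<le> (K + 2) * (?q * ?D + ?A)"
      using nn by (intro mult_right_mono) auto
    finally show "1 / real (n choose k) *
          (\<Sum>S | S \<subseteq> {1..n} \<and> card S = k.
            Lp_norm m n p (\<lambda>x. \<Sum>g\<in>Zsub m n S. fourier_coeff m n f g * character m n g x) powr p)
        \<le> (K + 2) * (?q * ?D + ?A)"
      by (simp only: S subset_average_def)
    have "?D \<le> 2 * ?U"
      unfolding Lp sum_distrib_left using p by (intro sum_mono mean_partial_deriv_le) auto
    then have "?q * ?D \<le> ?q * (2 * ?U)" using nn by (intro mult_left_mono)
    then have "?q * ?D \<le> 2 * (?q * ?U)" by (simp only: mult.left_commute)
    moreover have "d + a \<le> 2 * (u + a)" if "d \<le> 2 * u" "0 \<le> a" for a d u :: real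
      using that by simp
    ultimately have "?q * ?D + ?A \<le> 2 * (?q * ?U + ?A)" using nn(4) by blast
    also have "\<dots> \<le> (K + 2) * (?q * ?U + ?A)"
      using nn K by (intro mult_right_mono) auto
    finally show "?q * ?D + ?A \<le> (K + 2) * (?q * ?U + ?A)" .
  qed
qed

end
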